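(* Let $\mathfrak{g}=\mathbb{R}e_0\ltimes_M\mathfrak{u}$ be an almost abelian Lie algebra of dimension $2n+1$. Suppose that $M$ satisfies one of the following conditions: (i) $M\in\mathfrak{u}(n)$ and $\ker(M)$ is trivial; (ii) for some basis of $\mathfrak{u}$, $M=\left(\begin{array}{c|c|c}0&0&0\\ \hline 0&0&0\\ \hline 0&0&\tilde M\end{array}\right)$ with $\tilde M\in\mathfrak{u}(n-1)$; (iii) for some basis of $\mathfrak{u}$, $M=\left(\begin{array}{c|c|c}0&0&0\\ \hline 0&m&0\\ \hline 0&0&\tilde M\end{array}\right)$ with $m\neq 0$ and $\tilde M\in\mathfrak{u}(n-1)$; where in (ii) and (iii) the diagonal blocks have sizes $1$, $1$, $2n-2$. Then $\mathfrak{g}$ admits a coKähler structure $(\xi,\mathfrak{h},D)$. Moreover, all the possible vectors $\xi$ defining such a structure are determined: each vector listed below occurs as the $\xi$ of a coKähler structure on $\mathfrak{g}$, and these lists exhaust all possible choices of $\xi$ (in case (ii), the exhaustion is among coKähler structures for which $e_0$ is a unit vector orthogonal to $\mathfrak{u}$). In case (i), $\xi=te_0+w$ for any $t\neq 0$ and any $w\in\mathfrak{u}$. In case (ii), $\xi=\delta_1e_0+\delta_2u_0$ for any $u_0\in\ker(M)$, where $\delta_1,\delta_2\in\mathbb{R}$ and $\xi\neq 0$. In case (iii), $\xi$ is any unit vector in $\ker(M)$, where "unit" refers to the inner product of the coKähler structure.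
   Context: All Lie algebras are real and finite-dimensional. Almost abelian: $\mathfrak{g}=\mathbb{R}e_0\ltimes_M\mathfrak{u}$ means that $\mathfrak{u}$ is an abelian ideal of codimension one, $e_0\notin\mathfrak{u}$, and $M=\mathrm{ad}_{e_0}|_{\mathfrak{u}}$. Unitary matrices: $\mathfrak{u}(k)$ denotes the real $2k\times 2k$ matrices that are skew-symmetric and commute with a standard orthogonal complex structure of $\mathbb{R}^{2k}$. "$M\in\mathfrak{u}(n)$" means that there exist an inner product and an orthogonal complex structure on the vector space $\mathfrak{u}$ for which $M$ is skew-symmetric and commutes with the complex structure. CoKähler structure: a quadruple $(J,\xi,\alpha,\langle\cdot,\cdot\rangle)$ consisting of an endomorphism $J$ of $\mathfrak{g}$, a non-zero $\xi\in\mathfrak{g}$, $\alpha\in\mathfrak{g}^*$ and an inner product on $\mathfrak{g}$ with $\alpha(\xi)=1$, $J^2=-\mathrm{Id}+\alpha\otimes\xi$, $\langle JX,JY\rangle=\langle X,Y\rangle-\alpha(X)\alpha(Y)$, $d\alpha=0$, $N_J=0$, $d\omega=0$, where $\omega(X,Y)=\langle JX,Y\rangle$, $d$ is the Chevalley–Eilenberg differential and $N_J(X,Y)=[JX,JY]-J[JX,Y]-J[X,JY]+J^2[X,Y]$. It is encoded by the triple $(\xi,\mathfrak{h},D)$, where $\mathfrak{h}=\ker\alpha=\xi^\perp$ is a Kähler Lie algebra with the restrictions of $J$ and $\langle\cdot,\cdot\rangle$, $D=\mathrm{ad}_\xi|_{\mathfrak{h}}$ is a skew-symmetric derivation commuting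 with $J|_{\mathfrak{h}}$, and $\mathfrak{g}=\mathbb{R}\xi\ltimes_D\mathfrak{h}$. *)

theory Defs
  imports "HOL-Analysis.Analysis" "Jordan_Normal_Form.Matrix"
begin

section \<open>Lie algebras\<close>

text \<open>The underlying vector space is a type of class \<open>real_vector\<close>, so that no inner product is
  singled out. Finite-dimensionality is imposed where needed through \<open>dim UNIV\<close>, which is
  \<open>0\<close> on infinite-dimensional spaces; \<open>dim UNIV = 2 * n + 1\<close> therefore implies it.\<close>

definition lie_algebra :: "('a::real_vector \<Rightarrow> 'a \<Rightarrow> 'a) \<Rightarrow> bool" where
  "lie_algebra br \<longleftrightarrow> bilinear br \<and> (\<forall>x. br x x = 0) \<and>
     (\<forall>x y z. br x (br y z) + br y (br z x) + br z (br x y) = 0)"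

text \<open>\<open>\<gg> = \<real>e\<^sub>0 \<ltimes>\<^sub>M \<uu>\<close>. Here and below, an operator on a subspace is
  a function on the whole type of which only the values on the subspace are used.\<close>

definition almost_abelian ::
  "('a::real_vector \<Rightarrow> 'a \<Rightarrow> 'a) \<Rightarrow> 'a \<Rightarrow> 'a set \<Rightarrow> ('a \<Rightarrow> 'a) \<Rightarrow> bool" where
  "almost_abelian br e0 \<uu> M \<longleftrightarrow> lie_algebra br \<and> subspace \<uu> \<and>
     (\<forall>x. \<forall>y\<in>\<uu>. br x y \<in> \<uu>) \<and> (\<forall>x\<in>\<uu>. \<forall>y\<in>\<uu>. br x y = 0) \<and>
     dim \<uu> + 1 = dim (UNIV :: 'a set) \<and> e0 \<notin> \<uu> \<and> (\<forall>x\<in>\<uu>. M x = br e0 x)"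

definition ker_on :: "'a::real_vector set \<Rightarrow> ('a \<Rightarrow> 'a) \<Rightarrow> 'a set" where
  "ker_on V f = {x\<in>V. f x = 0}"


section \<open>Operators and inner products on a subspace\<close>

definition endo_on :: "'a::real_vector set \<Rightarrow> ('a \<Rightarrow> 'a) \<Rightarrow> bool" where
  "endo_on V f \<longleftrightarrow> (\<forall>x\<in>V. f x \<in> V) \<and> (\<forall>x\<in>V. \<forall>y\<in>V. f (x + y) = f x + f y) \<and>
     (\<forall>c. \<forall>x\<in>V. f (c *\<^sub>R x) = c *\<^sub>R f x)"

definition inner_product_on :: "'a::real_vector set \<Rightarrow> ('a \<Rightarrow> 'a \<Rightarrow> real) \<Rightarrow> bool" where
  "inner_product_on V ip \<longleftrightarrow>
     (\<forall>x\<in>V. \<forall>y\<in>V. \<forall>z\<in>V. ip (x + y) z = ip x z + ip y z) \<and>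
     (\<forall>c. \<forall>x\<in>V. \<forall>y\<in>V. ip (c *\<^sub>R x) y = c * ip x y) \<and>
     (\<forall>x\<in>V. \<forall>y\<in>V. ip x y = ip y x) \<and>
     (\<forall>x\<in>V. x \<noteq> 0 \<longrightarrow> ip x x > 0)"

definition skew_on ::
  "'a::real_vector set \<Rightarrow> ('a \<Rightarrow> 'a \<Rightarrow> real) \<Rightarrow> ('a \<Rightarrow> 'a) \<Rightarrow> bool" where
  "skew_on V ip f \<longleftrightarrow> (\<forall>x\<in>V. \<forall>y\<in>V. ip (f x) y = - ip x (f y))"

definition orthogonal_complex_structure_on ::
  "'a::real_vector set \<Rightarrow> ('a \<Rightarrow> 'a \<Rightarrow> real) \<Rightarrow> ('a \<Rightarrow> 'a) \<Rightarrow> bool" where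
  "orthogonal_complex_structure_on V ip J \<longleftrightarrow> endo_on V J \<and> (\<forall>x\<in>V. J (J x) = - x) \<and>
     (\<forall>x\<in>V. \<forall>y\<in>V. ip (J x) (J y) = ip x y)"

text \<open>\<open>M \<in> \<uu>(k)\<close> for an operator \<open>M\<close> on a vector space \<open>V\<close> of dimension \<open>2k\<close>.\<close>

definition unitary_operator ::
  "nat \<Rightarrow> 'a::real_vector set \<Rightarrow> ('a \<Rightarrow> 'a) \<Rightarrow> bool" where
  "unitary_operator k V M \<longleftrightarrow> dim V = 2 * k \<and> endo_on V M \<and>
     (\<exists>ip J. inner_product_on V ip \<and> orthogonal_complex_structure_on V ip J \<and>
       skew_on V ip M \<and> (\<forall>x\<in>V. M (J x) = J (M x)))"

text \<open>The matrix Lie algebra \<open>\<uu>(k)\<close> of real matrices of size \<open>2k\<close>.\<close>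

definition std_complex_structure :: "nat \<Rightarrow> real mat" where
  "std_complex_structure k = four_block_mat (0\<^sub>m k k) (- 1\<^sub>m k) (1\<^sub>m k) (0\<^sub>m k k)"

definition unitary_matrices :: "nat \<Rightarrow> real mat set" where
  "unitary_matrices k = {A \<in> carrier_mat (2 * k) (2 * k). transpose_mat A = - A \<and>
     A * std_complex_structure k = std_complex_structure k * A}"

definition basis_of :: "'a::real_vector list \<Rightarrow> 'a set \<Rightarrow> bool" where
  "basis_of bs V \<longleftrightarrow> distinct bs \<and> independent (set bs) \<and> span (set bs) = V"

definition matrix_wrt :: "'a::real_vector list \<Rightarrow> ('a \<Rightarrow> 'a) \<Rightarrow> real mat \<Rightarrow> bool" where
  "matrix_wrt bs f A \<longleftrightarrow> A \<in> carrier_mat (length bs) (length bs) \<and>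
     (\<forall>j<length bs. f (bs ! j) = (\<Sum>i<length bs. (A $$ (i, j)) *\<^sub>R (bs ! i)))"


section \<open>The three conditions on \<open>M\<close>\<close>

definition cond_i :: "nat \<Rightarrow> 'a::real_vector set \<Rightarrow> ('a \<Rightarrow> 'a) \<Rightarrow> bool" where
  "cond_i n \<uu> M \<longleftrightarrow> unitary_operator n \<uu> M \<and> ker_on \<uu> M = {0}"

definition cond_ii :: "nat \<Rightarrow> 'a::real_vector set \<Rightarrow> ('a \<Rightarrow> 'a) \<Rightarrow> bool" where
  "cond_ii n \<uu> M \<longleftrightarrow> n \<ge> 1 \<and> (\<exists>bs. \<exists>Mt\<in>unitary_matrices (n - 1). basis_of bs \<uu> \<and>
     matrix_wrt bs M (diag_block_mat [0\<^sub>m 1 1, 0\<^sub>m 1 1, Mt]))"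

definition cond_iii :: "nat \<Rightarrow> 'a::real_vector set \<Rightarrow> ('a \<Rightarrow> 'a) \<Rightarrow> bool" where
  "cond_iii n \<uu> M \<longleftrightarrow> n \<ge> 1 \<and> (\<exists>bs m. \<exists>Mt\<in>unitary_matrices (n - 1). basis_of bs \<uu> \<and>
     m \<noteq> 0 \<and> matrix_wrt bs M (diag_block_mat [0\<^sub>m 1 1, m \<cdot>\<^sub>m 1\<^sub>m 1, Mt]))"


section \<open>Kaehler and coKaehler structures\<close>

text \<open>Chevalley--Eilenberg differential (trivial coefficients) of 1-forms and of 2-forms.\<close>

definition ce_diff1 ::
  "('a::real_vector \<Rightarrow> 'a \<Rightarrow> 'a) \<Rightarrow> ('a \<Rightarrow> real) \<Rightarrow> 'a \<Rightarrow> 'a \<Rightarrow> real" where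
  "ce_diff1 br \<alpha> x y = - \<alpha> (br x y)"

definition ce_diff2 ::
  "('a::real_vector \<Rightarrow> 'a \<Rightarrow> 'a) \<Rightarrow> ('a \<Rightarrow> 'a \<Rightarrow> real) \<Rightarrow> 'a \<Rightarrow> 'a \<Rightarrow> 'a \<Rightarrow> real" where
  "ce_diff2 br \<omega> x y z = - \<omega> (br x y) z + \<omega> (br x z) y - \<omega> (br y z) x"

definition nijenhuis ::
  "('a::real_vector \<Rightarrow> 'a \<Rightarrow> 'a) \<Rightarrow> ('a \<Rightarrow> 'a) \<Rightarrow> 'a \<Rightarrow> 'a \<Rightarrow> 'a" where
  "nijenhuis br J x y =
     br (J x) (J y) - J (br (J x) y) - J (br x (J y)) + J (J (br x y))"

definition cokahler_structure ::
  "('a::real_vector \<Rightarrow> 'a \<Rightarrow> 'a) \<Rightarrow> ('a \<Rightarrow> 'a) \<Rightarrow> 'a \<Rightarrow> ('a \<Rightarrow> real) \<Rightarrow>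
     ('a \<Rightarrow> 'a \<Rightarrow> real) \<Rightarrow> bool" where
  "cokahler_structure br J \<xi> \<alpha> ip \<longleftrightarrow>
     linear J \<and> \<xi> \<noteq> 0 \<and> linear \<alpha> \<and> inner_product_on UNIV ip \<and>
     \<alpha> \<xi> = 1 \<and>
     (\<forall>x. J (J x) = - x + \<alpha> x *\<^sub>R \<xi>) \<and>
     (\<forall>x y. ip (J x) (J y) = ip x y - \<alpha> x * \<alpha> y) \<and>
     (\<forall>x y. ce_diff1 br \<alpha> x y = 0) \<and>
     (\<forall>x y. nijenhuis br J x y = 0) \<and>
     (\<forall>x y z. ce_diff2 br (\<lambda>u v. ip (J u) v) x y z = 0)"

definition kahler_on ::
  "('a::real_vector \<Rightarrow> 'a \<Rightarrow> 'a) \<Rightarrow> 'a set \<Rightarrow> ('a \<Rightarrow> 'a) \<Rightarrow> ('a \<Rightarrow> 'a \<Rightarrow> real) \<Rightarrow> bool" where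
  "kahler_on br \<hh> J ip \<longleftrightarrow>
     subspace \<hh> \<and> (\<forall>x\<in>\<hh>. \<forall>y\<in>\<hh>. br x y \<in> \<hh>) \<and>
     inner_product_on \<hh> ip \<and> orthogonal_complex_structure_on \<hh> ip J \<and>
     (\<forall>x\<in>\<hh>. \<forall>y\<in>\<hh>. nijenhuis br J x y = 0) \<and>
     (\<forall>x\<in>\<hh>. \<forall>y\<in>\<hh>. \<forall>z\<in>\<hh>. ce_diff2 br (\<lambda>u v. ip (J u) v) x y z = 0)"

text \<open>The triple \<open>(\<xi>, \<hh>, D)\<close> encoding some coKaehler structure. Everything after
  \<open>\<hh> = {x. \<alpha> x = 0}\<close> and \<open>D x = br \<xi> x\<close> is a consequence of the axioms of a coKaehler
  structure and is listed to spell out what the triple stands for. The last line says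
  \<open>\<gg> = \<real>\<xi> \<ltimes>\<^sub>D \<hh>\<close>.\<close>

definition cokahler_triple ::
  "('a::real_vector \<Rightarrow> 'a \<Rightarrow> 'a) \<Rightarrow> 'a \<Rightarrow> 'a set \<Rightarrow> ('a \<Rightarrow> 'a) \<Rightarrow> bool" where
  "cokahler_triple br \<xi> \<hh> D \<longleftrightarrow> (\<exists>J \<alpha> ip. cokahler_structure br J \<xi> \<alpha> ip \<and>
     \<hh> = {x. \<alpha> x = 0} \<and> (\<forall>x\<in>\<hh>. D x = br \<xi> x) \<and>
     \<hh> = {x. ip \<xi> x = 0} \<and> kahler_on br \<hh> J ip \<and>
     endo_on \<hh> D \<and> skew_on \<hh> ip D \<and>
     (\<forall>x\<in>\<hh>. \<forall>y\<in>\<hh>. D (br x y) = br (D x) y + br x (D y)) \<and>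
     (\<forall>x\<in>\<hh>. D (J x) = J (D x)) \<and>
     (\<forall>x. \<forall>y\<in>\<hh>. br x y \<in> \<hh>) \<and> \<xi> \<notin> \<hh> \<and> span (insert \<xi> \<hh>) = UNIV)"

end

(* The brackets are [x, y] = a(x) L(y) - a(y) L(x) with L = ad e0 and a the functional with kernel u
   and a(e0) = 1. Two constructions give all the structures. If L|u is unitary, every xi = t e0 + w
   with t nonzero is made a unit normal of h = u. If u = R b0 + R b1 + W with L b0 = 0, L b1 = m b1 and
   L|W unitary, then xi = b0 with J e0 = b1 works for every m, zero or not, and an automorphism
   x |-> x + f(x) (xi - b0), where f vanishes on the range of L, moves b0 to any nonzero vector of ker L.
   For the converse, ad xi is skew and alpha kills brackets: in (i) L|u is onto, so alpha|u = 0;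
   in (iii) b1 is an eigenvector of ad xi with eigenvalue a(xi) m, so a(xi) = 0; and when e0 is
   orthogonal to the image of u under ad xi, skewness gives L(xi) = 0. *)
theory Submission
  imports Defs
begin

text \<open>Both constructions use one mechanism: if K and L are skew and commute, then K L is
  symmetric, and this symmetry cancels the terms of d omega. An arbitrary m does no harm because b0
  is central and e0, b1 span a two-dimensional subalgebra, where integrability of J and closedness
  of omega are automatic.

  The kernel of M can exceed the line of b0, since the unitary block may have a kernel of its own,
  and each nonzero vector of it has to be reached. Rather than change the basis and the splitting
  for each target, one structure is moved by an automorphism. Its functional f must vanish on the
  range of L but not at the target; it exists because skewness on W keeps nonzero kernel vectors out
  of that range.

  In (ii) the constructions complement each other: vectors with an e0-component come from the first,
  since m = 0 lets b0 and b1 form a complex line, and those in the kernel from the second. If M is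
  not zero, e0 + w with w outside ker M also occurs, which is why exhaustion in (ii) asks for e0
  orthogonal to u.\<close>

section \<open>Linear algebra behind the bracket formula\<close>

text \<open>A vector of \<open>span T\<close> outside \<open>span B\<close> could be added to
  \<open>B\<close>, giving an independent set larger than \<open>T\<close> inside
  \<open>span T\<close>.\<close>

lemma subset_span_if_card_le:
  fixes B T :: "'a::real_vector set"
  assumes "finite T" "independent B" "B \<subseteq> span T" "card T \<le> card B"
  shows "span T \<subseteq> span B"
proof
  fix x assume x: "x \<in> span T"
  show "x \<in> span B"
  proof (rule ccontr)
    assume nx: "x \<notin> span B"
    then have "independent (insert x B)" using assms(2) by (rule real_vector.independent_insertI)
    from real_vector.independent_span_bound[OF assms(1) this] assms(3) x
    have "finite (insert x B)" "card (insert x B) \<le> card T" by auto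
    moreover have "x \<notin> B" using nx by (meson real_vector.span_base)
    ultimately show False using assms(4) by simp
  qed
qed

text \<open>Prescribe 1 at \<open>v\<close> and 0 on a basis of \<open>span S\<close>, then extend
  linearly; no inner product has to be chosen.\<close>

lemma separating_functional:
  fixes v :: "'a::real_vector"
  assumes "v \<notin> span S"
  obtains f :: "'a \<Rightarrow> real" where "linear f" "f v = 1" "\<And>x. x \<in> span S \<Longrightarrow> f x = 0"
proof -
  obtain B where B: "B \<subseteq> span S" "independent B" "span S \<subseteq> span B"
    by (rule real_vector.basis_exists[of "span S"])
  have sp: "span B = span S"
    using B by (metis real_vector.span_minimal real_vector.subspace_span subset_antisym)
  have "independent (insert v B)"
    using B(2) assms sp by (metis real_vector.independent_insertI)
  then obtain f :: "'a \<Rightarrow> real"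
    where f: "linear f" "\<forall>x\<in>insert v B. f x = (if x = v then 1 else 0)"
    using linear_independent_extend[of "insert v B" "\<lambda>x. if x = v then 1 else 0"] by blast
  have "v \<notin> B" using assms sp by (metis real_vector.span_base)
  then have "f x = 0" if "x \<in> B" for x using f(2) that by auto
  then have "f x = 0" if "x \<in> span S" for x
    using linear_eq_0_on_span[of f B x] f(1) that sp by auto
  then show ?thesis using that f by auto
qed

text \<open>Codimension one is given only through \<open>dim\<close>, so the splitting of a vector
  into a multiple of \<open>e0\<close> and a part in the ideal comes from counting:
  \<open>e0\<close> and a basis of the ideal form an independent set as large as a basis of the
  whole space. The bracket formula is then bilinearity together with the ideal being
  abelian.\<close>

lemma almost_abelian_functional:
  fixes br :: "'a::real_vector \<Rightarrow> 'a \<Rightarrow> 'a"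
  assumes "almost_abelian br e0 \<uu> M"
  obtains a where "linear a" "a e0 = 1" "\<And>x. x \<in> \<uu> \<longleftrightarrow> a x = 0" "\<And>x. x - a x *\<^sub>R e0 \<in> \<uu>"
    "\<And>x y. br x y = a x *\<^sub>R br e0 y - a y *\<^sub>R br e0 x"
proof -
  have bl: "bilinear br" and alt: "br x x = 0" and sub: "subspace \<uu>"
    and ab: "x \<in> \<uu> \<Longrightarrow> y \<in> \<uu> \<Longrightarrow> br x y = 0" and dim: "dim \<uu> + 1 = dim (UNIV :: 'a set)"
    and e0: "e0 \<notin> \<uu>" for x y
    using assms unfolding almost_abelian_def lie_algebra_def by auto
  have su: "span \<uu> = \<uu>" using sub by simp
  obtain B where B: "B \<subseteq> \<uu>" "independent B" "\<uu> \<subseteq> span B" "card B = dim \<uu>"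
    by (rule real_vector.basis_exists)
  obtain T :: "'a set" where T: "independent T" "UNIV \<subseteq> span T" "card T = dim (UNIV :: 'a set)"
    using real_vector.basis_exists[of UNIV] by metis
  \<comment> \<open>An infinite set has \<open>card\<close> 0, whereas \<open>card T\<close> is
    \<open>dim \<uu> + 1\<close>.\<close>
  have fT: "finite T" using T(3) dim by (intro card_ge_0_finite) simp
  have sB: "span B = \<uu>" using B su by (metis real_vector.span_mono subset_antisym)
  have iB: "independent (insert e0 B)" using B e0 sB by (simp add: real_vector.independent_insertI)
  have "finite (insert e0 B)"
    using real_vector.independent_span_bound[OF fT iB] T(2) by auto
  then have "card (insert e0 B) = card T"
    using B(1,4) T(3) dim e0 by (subst card_insert_disjoint) auto
  then have "UNIV \<subseteq> span (insert e0 B)"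
    using subset_span_if_card_le[OF fT iB] T(2) by auto
  then have dec: "\<exists>k. x - k *\<^sub>R e0 \<in> \<uu>" for x
    using sB by (auto simp: real_vector.span_breakdown_eq)
  obtain a :: "'a \<Rightarrow> real" where a: "linear a" "a e0 = 1" "\<And>x. x \<in> \<uu> \<Longrightarrow> a x = 0"
    using separating_functional[of e0 \<uu>] e0 su by metis
  have dec': "x - a x *\<^sub>R e0 \<in> \<uu>" for x
  proof -
    obtain k where k: "x - k *\<^sub>R e0 \<in> \<uu>" using dec by blast
    then have "a x = k" using a(3)[OF k] a(1,2) by (simp add: linear_diff linear_scale)
    then show ?thesis using k by simp
  qed
  have "br x y = a x *\<^sub>R br e0 y - a y *\<^sub>R br e0 x" for x y
  proof -
    define x' y' where "x' = x - a x *\<^sub>R e0" and "y' = y - a y *\<^sub>R e0"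
    have x: "x = x' + a x *\<^sub>R e0" and y: "y = y' + a y *\<^sub>R e0" by (auto simp: x'_def y'_def)
    have u: "br x' y' = 0" using ab dec' by (auto simp: x'_def y'_def)
    have anti: "br z e0 = - br e0 z" for z
      using alt[of "z + e0"] alt[of z] alt[of e0] bl
      by (simp add: bilinear_ladd bilinear_radd eq_neg_iff_add_eq_0 add.commute)
    have "br x y = br (x' + a x *\<^sub>R e0) (y' + a y *\<^sub>R e0)" using x y by simp
    also have "\<dots> = a x *\<^sub>R br e0 y' - a y *\<^sub>R br e0 x'"
      using bl u alt[of e0] anti[of x']
      by (simp add: bilinear_ladd bilinear_radd bilinear_lmul bilinear_rmul algebra_simps)
    also have "\<dots> = a x *\<^sub>R br e0 y - a y *\<^sub>R br e0 x"
      unfolding x'_def y'_def using bl alt[of e0]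
      by (simp add: bilinear_rsub bilinear_rmul)
    finally show ?thesis .
  qed
  moreover have "x \<in> \<uu> \<longleftrightarrow> a x = 0" for x using a(3) dec'[of x] by auto
  ultimately show ?thesis using that a dec' by blast
qed

section \<open>Consequences of the coKaehler axioms\<close>

context
  fixes br :: "'a::real_vector \<Rightarrow> 'a \<Rightarrow> 'a" and J \<xi> \<alpha> ip
  assumes ck: "cokahler_structure br J \<xi> \<alpha> ip"
begin

lemma cokahler_linear: "linear J" "linear \<alpha>"
  and cokahler_inner: "inner_product_on UNIV ip"
  and cokahler_alpha_xi: "\<alpha> \<xi> = 1"
  and cokahler_JJ: "J (J x) = - x + \<alpha> x *\<^sub>R \<xi>"
  and cokahler_ip_J: "ip (J x) (J y) = ip x y - \<alpha> x * \<alpha> y"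
  and cokahler_alpha_br: "\<alpha> (br x y) = 0"
  and cokahler_nijenhuis: "nijenhuis br J x y = 0"
  and cokahler_closed: "ce_diff2 br (\<lambda>u v. ip (J u) v) x y z = 0"
  using ck unfolding cokahler_structure_def ce_diff1_def by auto

lemma cokahler_ip:
  shows "ip (x + y) z = ip x z + ip y z" "ip (c *\<^sub>R x) y = c * ip x y" "ip x y = ip y x"
    "ip 0 x = 0" "ip (- x) y = - ip x y" "ip x (- y) = - ip x y" "ip x 0 = 0"
    "ip x x = 0 \<longleftrightarrow> x = 0" "x \<noteq> 0 \<Longrightarrow> ip x x > 0" "ip x (y + z) = ip x y + ip x z" "ip x (c *\<^sub>R y) = c * ip x y"
proof -
  have add: "ip (x + y) z = ip x z + ip y z" and sc: "ip (c *\<^sub>R x) y = c * ip x y"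
    and sym: "ip x y = ip y x" and pos: "x \<noteq> 0 \<Longrightarrow> ip x x > 0" for x y z c
    using cokahler_inner unfolding inner_product_on_def by auto
  show "ip (x + y) z = ip x z + ip y z" "ip (c *\<^sub>R x) y = c * ip x y" "ip x y = ip y x"
    by (rule add sc sym)+
  show z: "ip 0 x = 0" for x using sc[of 0 x x] by simp
  then show "ip x 0 = 0" using sym by metis
  show n: "ip (- x) y = - ip x y" for x y using sc[of "-1" x y] by simp
  then show "ip x (- y) = - ip x y" using sym by metis
  show "x \<noteq> 0 \<Longrightarrow> ip x x > 0" by (rule pos)
  show "ip x x = 0 \<longleftrightarrow> x = 0" using pos[of x] z by fastforce
  show "ip x (y + z) = ip x y + ip x z" "ip x (c *\<^sub>R y) = c * ip x y"
    using add sc sym by metis+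
qed

text \<open>The second and third powers of \<open>J\<close> kill \<open>\<xi>\<close>, so
  \<open>J \<xi>\<close> is a multiple of \<open>\<xi>\<close>. Applying \<open>J\<close> again
  shows that the coefficient times \<open>J \<xi>\<close> vanishes, and either factor being zero
  suffices.\<close>

lemma cokahler_J_xi: "J \<xi> = 0"
proof -
  have 1: "J (J \<xi>) = 0" using cokahler_JJ[of \<xi>] cokahler_alpha_xi by simp
  have "J (J (J \<xi>)) = 0" using 1 linear_0[OF cokahler_linear(1)] by simp
  then have c: "J \<xi> = \<alpha> (J \<xi>) *\<^sub>R \<xi>" using cokahler_JJ[of "J \<xi>"] by (simp add: eq_neg_iff_add_eq_0)
  have "0 = \<alpha> (J \<xi>) *\<^sub>R J \<xi>" using 1 c linear_scale[OF cokahler_linear(1)] by metis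
  then show ?thesis using c by auto
qed

text \<open>Metric compatibility at the pair (\<open>\<xi>\<close>, \<open>\<xi>\<close>), where the
  left side vanishes. Hence "unit" in case (iii) is automatic for the inner product of the
  structure.\<close>

lemma cokahler_unit: "ip \<xi> \<xi> = 1"
  using cokahler_ip_J[of \<xi> \<xi>] by (simp add: cokahler_J_xi cokahler_ip cokahler_alpha_xi)

lemma cokahler_alpha_eq: "\<alpha> x = ip \<xi> x"
  using cokahler_ip_J[of \<xi> x] by (simp add: cokahler_J_xi cokahler_ip cokahler_alpha_xi)

text \<open>Two expansions of the third power of \<open>J\<close> at \<open>x\<close>, as J of the
  square and as the square at \<open>J x\<close>, differ by
  \<open>\<alpha> (J x) *\<^sub>R \<xi>\<close>.\<close>

lemma cokahler_alpha_J: "\<alpha> (J x) = 0"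
proof -
  have "J (- x + \<alpha> x *\<^sub>R \<xi>) = - J x + \<alpha> (J x) *\<^sub>R \<xi>" using cokahler_JJ[of "J x"] cokahler_JJ[of x] by simp
  then have "\<alpha> (J x) *\<^sub>R \<xi> = 0"
    using linear_add[OF cokahler_linear(1), of "- x" "\<alpha> x *\<^sub>R \<xi>"] linear_neg[OF cokahler_linear(1)]
    by (simp add: linear_scale[OF cokahler_linear(1)] cokahler_J_xi)
  then show ?thesis using cokahler_unit cokahler_ip(4) by auto
qed

lemma cokahler_J_eq_0: "J x = 0 \<Longrightarrow> \<alpha> x = 0 \<Longrightarrow> x = 0"
  using cokahler_JJ[of x] linear_0[OF cokahler_linear(1)] by simp

text \<open>Compatibility applied to \<open>J x\<close> and \<open>y\<close> moves \<open>J\<close>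
  across, because its square is minus the identity up to a multiple of \<open>\<xi>\<close>, and
  \<open>\<xi>\<close> is orthogonal to the image of \<open>J\<close>.\<close>

lemma cokahler_ip_J_left: "ip (J x) y = - ip x (J y)"
proof -
  have "ip (J x) y = ip (J (J x)) (J y)" using cokahler_ip_J[of "J x" y] by (simp add: cokahler_alpha_J)
  also have "\<dots> = - ip x (J y) + \<alpha> x * ip \<xi> (J y)"
    by (simp only: cokahler_JJ cokahler_ip(1,2,5))
  finally show ?thesis using cokahler_alpha_eq[of "J y"] by (simp add: cokahler_alpha_J)
qed

end

lemma inner_product_on_subset:
  assumes "inner_product_on V ip" "W \<subseteq> V"
  shows "inner_product_on W ip"
proof -
  note ip = assms(1)[unfolded inner_product_on_def]
  show ?thesis unfolding inner_product_on_def
    by (intro conjI ballI allI impI)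
      (rule ip[THEN conjunct1, rule_format] ip[THEN conjunct2, THEN conjunct1, rule_format]
        ip[THEN conjunct2, THEN conjunct2, THEN conjunct1, rule_format]
        ip[THEN conjunct2, THEN conjunct2, THEN conjunct2, rule_format];
        (assumption | erule subsetD[OF assms(2)]))+
qed

context
  fixes br :: "'a::real_vector \<Rightarrow> 'a \<Rightarrow> 'a" and J \<xi> \<alpha> ip
  assumes ck: "cokahler_structure br J \<xi> \<alpha> ip" and lie: "lie_algebra br"
begin

text \<open>With \<open>J \<xi> = 0\<close> the Nijenhuis tensor at \<open>\<xi>\<close> and
  \<open>y\<close> is \<open>J\<close> of the difference of the two sides. That difference lies in
  the kernel of \<open>\<alpha>\<close>, where \<open>J\<close> is injective.\<close>

lemma cokahler_ad_J: "J (br \<xi> y) = br \<xi> (J y)"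
proof -
  note lJ = cokahler_linear(1)[OF ck] and l\<alpha> = cokahler_linear(2)[OF ck]
  have "br 0 z = 0" for z using lie by (simp add: lie_algebra_def bilinear_lzero)
  then have "J (J (br \<xi> y) - br \<xi> (J y)) = 0"
    using cokahler_nijenhuis[OF ck, of \<xi> y]
    by (simp add: nijenhuis_def cokahler_J_xi[OF ck] linear_diff[OF lJ] linear_0[OF lJ])
  moreover have "\<alpha> (J (br \<xi> y) - br \<xi> (J y)) = 0"
    by (simp add: linear_diff[OF l\<alpha>] cokahler_alpha_br[OF ck] cokahler_alpha_J[OF ck])
  ultimately show ?thesis using cokahler_J_eq_0[OF ck] by force
qed

text \<open>Closedness of omega at (\<open>\<xi>\<close>, \<open>x\<close>, \<open>y\<close>), with
  \<open>J\<close> commuted past ad of \<open>\<xi>\<close>, yields skewness only for arguments in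
  the image of \<open>J\<close>. Every vector is such an argument plus a multiple of
  \<open>\<xi>\<close>, and that multiple contributes nothing, since \<open>br \<xi> \<xi>\<close>
  and \<open>\<alpha> (br \<xi> y)\<close> vanish.\<close>

lemma cokahler_ad_skew: "ip (br \<xi> x) y = - ip x (br \<xi> y)"
proof -
  note ips = cokahler_ip[OF ck] and JJ = cokahler_ip_J_left[OF ck]
  have J: "ip (br \<xi> (J x)) y = - ip (J x) (br \<xi> y)" for x
  proof -
    \<comment> \<open>This is the third term of d omega; it vanishes because the image of
      \<open>J\<close> is orthogonal to \<open>\<xi>\<close>.\<close>
    have "ip (J (br x y)) \<xi> = 0"
      using ips(3) cokahler_alpha_eq[OF ck] cokahler_alpha_J[OF ck] by metis
    then have "ip (J (br \<xi> x)) y = ip (J (br \<xi> y)) x"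
      using cokahler_closed[OF ck, of \<xi> x y] by (simp add: ce_diff2_def)
    then show ?thesis using JJ[of "br \<xi> y" x] ips(3) cokahler_ad_J by metis
  qed
  have bl: "bilinear br" and "br \<xi> \<xi> = 0" using lie by (auto simp: lie_algebra_def)
  have x: "x = - J (J x) + \<alpha> x *\<^sub>R \<xi>" using cokahler_JJ[OF ck, of x] by simp
  have "br \<xi> x = - br \<xi> (J (J x)) + \<alpha> x *\<^sub>R br \<xi> \<xi>"
    using bl by (subst x) (simp only: bilinear_radd bilinear_rneg bilinear_rmul)
  then have "br \<xi> x = - br \<xi> (J (J x))" using \<open>br \<xi> \<xi> = 0\<close> by simp
  moreover have "ip x (br \<xi> y) = - ip (J (J x)) (br \<xi> y)"
    using cokahler_alpha_eq[OF ck, of "br \<xi> y"] cokahler_alpha_br[OF ck, of \<xi> y]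
    using x ips(1)[of "- J (J x)" "\<alpha> x *\<^sub>R \<xi>"] ips(2)[of "\<alpha> x" \<xi>] ips(5) by simp
  ultimately show ?thesis by (simp only: ips(5) J minus_minus)
qed

text \<open>Closedness of \<open>\<alpha>\<close> puts every bracket into its kernel, which is
  therefore an ideal; the derivation rule is the Jacobi identity, and the other properties are
  restrictions of identities valid everywhere.\<close>

lemma cokahler_triple_ad: "cokahler_triple br \<xi> {x. \<alpha> x = 0} (br \<xi>)"
proof -
  note lJ = cokahler_linear(1)[OF ck] and l\<alpha> = cokahler_linear(2)[OF ck]
    and \<alpha>br = cokahler_alpha_br[OF ck]
  have bl: "bilinear br" and alt: "br x x = 0"
    and jac: "br x (br y z) + br y (br z x) + br z (br x y) = 0" for x y z
    using lie by (auto simp: lie_algebra_def)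
  have anti: "br x y = - br y x" for x y
    using alt[of "x + y"] alt[of x] alt[of y] bl
    by (simp add: bilinear_ladd bilinear_radd eq_neg_iff_add_eq_0)
  have sub: "subspace {x. \<alpha> x = 0}"
    by (auto simp: subspace_def linear_0[OF l\<alpha>] linear_add[OF l\<alpha>] linear_scale[OF l\<alpha>])
  have der: "br \<xi> (br x y) = br (br \<xi> x) y + br x (br \<xi> y)" for x y
  proof -
    have "br y (br \<xi> x) = - br (br \<xi> x) y" by (rule anti)
    moreover have "br x (br y \<xi>) = - br x (br \<xi> y)"
      using anti[of y \<xi>] bl by (simp add: bilinear_rneg)
    ultimately have "br \<xi> (br x y) + - br x (br \<xi> y) + - br (br \<xi> x) y = 0"
      using jac[of \<xi> x y] by simp
    then show ?thesis by (simp add: algebra_simps)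
  qed
  have span: "x \<in> span (insert \<xi> {x. \<alpha> x = 0})" for x
    unfolding real_vector.span_breakdown_eq
    by (rule exI[of _ "\<alpha> x"], rule real_vector.span_base)
      (simp add: linear_diff[OF l\<alpha>] linear_scale[OF l\<alpha>] cokahler_alpha_xi[OF ck])
  have "inner_product_on {x. \<alpha> x = 0} ip" using inner_product_on_subset[OF cokahler_inner[OF ck]] by simp
  moreover have "orthogonal_complex_structure_on {x. \<alpha> x = 0} ip J"
    by (auto simp: orthogonal_complex_structure_on_def endo_on_def cokahler_alpha_J[OF ck]
      linear_add[OF lJ] linear_scale[OF lJ] cokahler_JJ[OF ck] cokahler_ip_J[OF ck])
  ultimately have "kahler_on br {x. \<alpha> x = 0} J ip"
    using sub by (simp add: kahler_on_def \<alpha>br cokahler_nijenhuis[OF ck] cokahler_closed[OF ck])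
  moreover have "endo_on {x. \<alpha> x = 0} (br \<xi>)"
    using bl by (auto simp: endo_on_def \<alpha>br bilinear_radd bilinear_rmul)
  moreover have "{x. \<alpha> x = 0} = {x. ip \<xi> x = 0}" by (simp add: cokahler_alpha_eq[OF ck])
  moreover have "skew_on {x. \<alpha> x = 0} ip (br \<xi>)" using cokahler_ad_skew by (simp add: skew_on_def)
  moreover have "\<forall>x. \<forall>y\<in>{x. \<alpha> x = 0}. br x y \<in> {x. \<alpha> x = 0}" by (simp add: \<alpha>br)
  moreover have "\<xi> \<notin> {x. \<alpha> x = 0}" by (simp add: cokahler_alpha_xi[OF ck])
  moreover have "span (insert \<xi> {x. \<alpha> x = 0}) = UNIV" using span by blast
  ultimately show ?thesis unfolding cokahler_triple_def
    by (intro exI[of _ J] exI[of _ \<alpha>] exI[of _ ip] conjI ck ballI der cokahler_ad_J[symmetric] refl)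
qed

end

section \<open>Transport by automorphisms, and structures from a unitary ad of the Reeb
  vector\<close>

lemma cokahler_structure_transport:
  assumes ck: "cokahler_structure br J \<xi> \<alpha> ip" and lin: "linear \<phi>" "linear \<psi>"
    and inv: "\<And>x. \<phi> (\<psi> x) = x" "\<And>x. \<psi> (\<phi> x) = x"
    and hom: "\<And>x y. \<phi> (br x y) = br (\<phi> x) (\<phi> y)"
  shows "cokahler_structure br (\<phi> \<circ> J \<circ> \<psi>) (\<phi> \<xi>) (\<alpha> \<circ> \<psi>) (\<lambda>x y. ip (\<psi> x) (\<psi> y))"
proof -
  have hom': "\<psi> (br x y) = br (\<psi> x) (\<psi> y)" for x y using hom[of "\<psi> x" "\<psi> y"] inv by metis
  note lJ = cokahler_linear(1)[OF ck] and l\<alpha> = cokahler_linear(2)[OF ck]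
  have nz: "\<phi> x = 0 \<longleftrightarrow> x = 0" "\<psi> x = 0 \<longleftrightarrow> x = 0" for x
    using inv linear_0[OF lin(1)] linear_0[OF lin(2)] by metis+
  have "nijenhuis br (\<phi> \<circ> J \<circ> \<psi>) x y = \<phi> (nijenhuis br J (\<psi> x) (\<psi> y))" for x y
    by (simp add: nijenhuis_def linear_add[OF lin(1)] linear_diff[OF lin(1)] hom hom' inv)
  moreover have "inner_product_on UNIV (\<lambda>x y. ip (\<psi> x) (\<psi> y))"
    unfolding inner_product_on_def linear_add[OF lin(2)] linear_scale[OF lin(2)]
    using cokahler_ip(1,2,9)[OF ck] nz by (intro conjI ballI allI impI cokahler_ip(3)[OF ck]) simp_all
  moreover have "ce_diff2 br (\<lambda>u v. ip (\<psi> ((\<phi> \<circ> J \<circ> \<psi>) u)) (\<psi> v)) x y z = 0" for x y z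
    using cokahler_closed[OF ck, of "\<psi> x" "\<psi> y" "\<psi> z"] by (simp add: ce_diff2_def hom' inv)
  moreover have "linear (\<phi> \<circ> J \<circ> \<psi>)" "linear (\<alpha> \<circ> \<psi>)"
    by (intro linear_compose lin lJ l\<alpha>)+
  ultimately show ?thesis
    using ck unfolding cokahler_structure_def
    by (simp add: linear_0[OF lin(1)] linear_add[OF lin(1)] linear_neg[OF lin(1)] linear_diff[OF lin(1)]
      linear_scale[OF lin(1)] nz inv ce_diff1_def hom')
qed

text \<open>The complex structure and inner product of a unitary operator are known on
  \<open>W\<close> only. Composition with a projection onto \<open>W\<close> spreads them over the
  whole space, so that later identities need no membership conditions. In exchange, \<open>K\<close>
  squares to \<open>- \<pi>\<close> and \<open>g\<close> is only semidefinite, degenerate along the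
  kernel of \<open>\<pi>\<close>.\<close>

lemma unitary_operator_extend:
  fixes W :: "'a::real_vector set" and L :: "'a \<Rightarrow> 'a"
  assumes un: "unitary_operator k W L" and \<pi>: "linear \<pi>" "\<And>x. \<pi> x \<in> W" "\<And>x. x \<in> W \<Longrightarrow> \<pi> x = x"
  obtains K :: "'a \<Rightarrow> 'a" and g :: "'a \<Rightarrow> 'a \<Rightarrow> real" where
    "linear K" "\<And>x. K x \<in> W" "\<And>x. K (K x) = - \<pi> x" "\<And>x. K (\<pi> x) = K x"
    "\<And>x. K (L (\<pi> x)) = L (K x)"
    "\<And>x y z. g (x + y) z = g x z + g y z" "\<And>c x y. g (c *\<^sub>R x) y = c * g x y"
    "\<And>x y. g x y = g y x" "\<And>x. g x x \<ge> 0" "\<And>x. g x x = 0 \<Longrightarrow> \<pi> x = 0"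
    "\<And>x y. g (\<pi> x) y = g x y" "\<And>x y. g (K x) (K y) = g x y"
    "\<And>x y. g (L (\<pi> x)) y = - g x (L (\<pi> y))"
proof -
  obtain h J where endo: "endo_on W L" and ip: "inner_product_on W h"
    and J: "orthogonal_complex_structure_on W h J" and sk: "skew_on W h L"
    and com: "\<And>x. x \<in> W \<Longrightarrow> L (J x) = J (L x)"
    using un unfolding unitary_operator_def by blast
  have JW: "x \<in> W \<Longrightarrow> J x \<in> W" and JJ: "x \<in> W \<Longrightarrow> J (J x) = - x"
    and Jh: "x \<in> W \<Longrightarrow> y \<in> W \<Longrightarrow> h (J x) (J y) = h x y"
    and Jlin: "x \<in> W \<Longrightarrow> y \<in> W \<Longrightarrow> J (x + y) = J x + J y" "x \<in> W \<Longrightarrow> J (c *\<^sub>R x) = c *\<^sub>R J x"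
    and LW: "x \<in> W \<Longrightarrow> L x \<in> W" for x y c
    using J endo unfolding orthogonal_complex_structure_on_def endo_on_def by auto
  have h: "x \<in> W \<Longrightarrow> y \<in> W \<Longrightarrow> z \<in> W \<Longrightarrow> h (x + y) z = h x z + h y z"
    "x \<in> W \<Longrightarrow> y \<in> W \<Longrightarrow> h (c *\<^sub>R x) y = c * h x y"
    "x \<in> W \<Longrightarrow> x \<noteq> 0 \<Longrightarrow> h x x > 0" for x y z c
    using ip unfolding inner_product_on_def by auto
  have sym: "x \<in> W \<Longrightarrow> y \<in> W \<Longrightarrow> h x y = h y x" for x y
    using ip unfolding inner_product_on_def by blast
  have h0: "h 0 0 = 0"
    using h(2)[of "\<pi> 0" "\<pi> 0" 0] \<pi>(2)[of 0] by (simp add: linear_0[OF \<pi>(1)])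
  have "h (\<pi> x) (\<pi> x) \<ge> 0" "h (\<pi> x) (\<pi> x) = 0 \<Longrightarrow> \<pi> x = 0" for x
    using h(3)[of "\<pi> x"] h0 \<pi>(2) by (cases "\<pi> x = 0"; force)+
  moreover have "linear (\<lambda>x. J (\<pi> x))"
    by (rule linearI) (simp_all add: linear_add[OF \<pi>(1)] linear_scale[OF \<pi>(1)] Jlin \<pi>)
  ultimately show ?thesis
    using sk
    by (intro that[of "\<lambda>x. J (\<pi> x)" "\<lambda>x y. h (\<pi> x) (\<pi> y)"])
      (simp_all add: \<pi> JW JJ LW com h(1,2) Jh sym[OF \<pi>(2) \<pi>(2)] linear_add[OF \<pi>(1)]
        linear_scale[OF \<pi>(1)] skew_on_def)
qed

text \<open>Take \<open>a\<close> as the 1-form, the zero extension \<open>K\<close> as the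
  endomorphism, and the metric making \<open>\<xi>\<close> a unit normal of the ideal. Since the
  ideal is abelian, the Nijenhuis tensor sees only that \<open>K\<close> commutes with ad of
  \<open>\<xi>\<close>.\<close>

lemma cokahler_structure_semidirect:
  fixes br :: "'a::real_vector \<Rightarrow> 'a \<Rightarrow> 'a"
  assumes L: "linear (br \<xi>)" and a: "linear a" "a \<xi> = 1" "\<And>x. x \<in> \<uu> \<Longrightarrow> a x = 0"
    "\<And>x. x - a x *\<^sub>R \<xi> \<in> \<uu>"
    and br: "\<And>x y. br x y = a x *\<^sub>R br \<xi> y - a y *\<^sub>R br \<xi> x"
    and un: "unitary_operator k \<uu> (br \<xi>)"
  shows "\<exists>J \<alpha> ip. cokahler_structure br J \<xi> \<alpha> ip"
proof -
  define \<pi> where "\<pi> x = x - a x *\<^sub>R \<xi>" for x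
  have \<pi>: "linear \<pi>" "\<And>x. \<pi> x \<in> \<uu>" "\<And>x. x \<in> \<uu> \<Longrightarrow> \<pi> x = x"
    using a by (auto simp: \<pi>_def linear_add[OF a(1)] linear_scale[OF a(1)] algebra_simps intro!: linearI)
  obtain K g where K: "linear K" "\<And>x. K x \<in> \<uu>" "\<And>x. K (K x) = - \<pi> x" "\<And>x. K (\<pi> x) = K x"
    "\<And>x. K (br \<xi> (\<pi> x)) = br \<xi> (K x)"
    and g: "\<And>x y z. g (x + y) z = g x z + g y z" "\<And>c x y. g (c *\<^sub>R x) y = c * g x y"
    "\<And>x y. g x y = g y x" "\<And>x. g x x \<ge> 0" "\<And>x. g x x = 0 \<Longrightarrow> \<pi> x = 0"
    "\<And>x y. g (\<pi> x) y = g x y" "\<And>x y. g (K x) (K y) = g x y"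
    "\<And>x y. g (br \<xi> (\<pi> x)) y = - g x (br \<xi> (\<pi> y))"
    using unitary_operator_extend[OF un \<pi>] by blast
  have L\<xi>: "br \<xi> \<xi> = 0" using br[of \<xi> \<xi>] by simp
  then have L\<pi>: "br \<xi> (\<pi> x) = br \<xi> x" for x
    by (simp add: \<pi>_def linear_diff[OF L] linear_scale[OF L])
  have Lu: "br \<xi> x \<in> \<uu>" for x
    using un \<pi>(2) L\<pi>[of x] unfolding unitary_operator_def endo_on_def by metis
  have a0: "a (K x) = 0" "a (br \<xi> x) = 0" "\<pi> (br \<xi> x) = br \<xi> x" for x
    using K(2) Lu a(3) \<pi>(3) by auto
  have K\<xi>: "K \<xi> = 0" using K(4)[of \<xi>] a(2) by (simp add: \<pi>_def linear_0[OF K(1)])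
  have gn: "g (- x) y = - g x y" for x y using g(2)[of "-1" x y] by simp
  have gr: "g x (c *\<^sub>R y) = c * g x y" "g x (y + z) = g x y + g x z" for c x y z
    using g(1,2,3) by metis+
  have gK: "g (K x) y = - g x (K y)" for x y
  proof -
    have "g (K x) y = g (K (K x)) (K y)" by (simp add: g(7))
    then show ?thesis by (simp add: K(3) gn g(6))
  qed
  \<comment> \<open>The product of two commuting skew operators is symmetric. In d omega the terms
    pair off as omega(ad x, y) against omega(ad y, x), so this is all that closedness
    requires.\<close>
  have s: "g (K (br \<xi> x)) y = g (K (br \<xi> y)) x" for x y
    using gK[of "br \<xi> x" y] g(8)[of x "K y"] K(5)[of y] g(3)[of "K (br \<xi> y)" x]
    by (simp add: L\<pi>)
  define ip where "ip x y = a x * a y + g x y" for x y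
  have pos: "x = 0" if "ip x x \<le> 0" for x
  proof -
    have "a x * a x \<ge> 0" "a x * a x + g x x \<le> 0" using that by (simp_all add: ip_def)
    then have "a x * a x = 0" "g x x = 0" using g(4)[of x] by linarith+
    then show ?thesis using g(5)[of x] by (simp add: \<pi>_def)
  qed
  have abr: "a (br x y) = 0" for x y
    using br[of x y] by (simp add: linear_diff[OF a(1)] linear_scale[OF a(1)] a0)
  \<comment> \<open>\<open>not_le[symmetric]\<close> restates positivity as the contrapositive of
    \<open>pos\<close>.\<close>
  have inner: "inner_product_on UNIV ip"
    unfolding inner_product_on_def not_le[symmetric]
  proof (intro conjI ballI allI impI)
    show "ip x y = ip y x" for x y using g(3)[of x y] by (simp add: ip_def)
  qed (use pos in \<open>auto simp: ip_def g(1,2) linear_add[OF a(1)] linear_scale[OF a(1)] algebra_simps\<close>)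
  have nz: "\<xi> \<noteq> 0" using a(1,2) linear_0 by force
  have nij: "nijenhuis br K x y = 0" for x y
    using K(3)[of "br \<xi> x"] K(3)[of "br \<xi> y"] K(5)[of "K x"] K(5)[of "K y"] K(3)[of x] K(3)[of y]
    unfolding nijenhuis_def br[of "K x"] br[of x "K y"] br[of x y]
    by (simp add: a0 L\<pi> linear_diff[OF K(1)] linear_scale[OF K(1)] linear_neg[OF K(1)] linear_neg[OF L])
  have closed: "ce_diff2 br (\<lambda>u v. ip (K u) v) x y z = 0" for x y z
    using s[of x y] s[of x z] s[of y z]
    by (simp add: ce_diff2_def ip_def a0 br[of x] br[of y] diff_conv_add_uminus linear_add[OF K(1)]
       linear_scale[OF K(1)] linear_neg[OF K(1)] g(1,2) gn del: add_uminus_conv_diff)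
  have "cokahler_structure br K \<xi> a ip"
    unfolding cokahler_structure_def
    by (intro conjI allI K(1) a(1,2) inner nz nij closed)
      (simp_all add: ce_diff1_def abr a0 K(3) \<pi>_def ip_def g(7) linear_diff[OF a(1)] linear_scale[OF a(1)])
  then show ?thesis by blast
qed

section \<open>The structure with Reeb vector b0 and its images under automorphisms\<close>

text \<open>Each of \<open>b0\<close>, \<open>b1\<close> lies outside the span of the other one,
  \<open>rs\<close> and \<open>e0\<close>. Keeping \<open>e0\<close> in that span makes the
  coordinate functionals vanish at \<open>e0\<close> as well.\<close>

lemma basis_coordinates:
  fixes a :: "'a::real_vector \<Rightarrow> real"
  assumes a: "\<And>x. x \<in> \<uu> \<longleftrightarrow> a x = 0" "\<And>x. x - a x *\<^sub>R e0 \<in> \<uu>" "a e0 = 1"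
    and bs: "basis_of (b0 # b1 # rs) \<uu>"
  obtains p q where "linear p" "linear q" "p e0 = 0" "q e0 = 0"
    "p b0 = 1" "p b1 = 0" "q b0 = 0" "q b1 = 1"
    "\<And>x. x \<in> span (set rs) \<Longrightarrow> p x = 0" "\<And>x. x \<in> span (set rs) \<Longrightarrow> q x = 0"
    "\<And>x. x - a x *\<^sub>R e0 - p x *\<^sub>R b0 - q x *\<^sub>R b1 \<in> span (set rs)"
proof -
  define R where "R = set rs"
  have ind: "independent (insert b0 (insert b1 R))" and sp: "span (insert b0 (insert b1 R)) = \<uu>"
    and dist: "b0 \<noteq> b1" "b0 \<notin> R" "b1 \<notin> R"
    using bs by (auto simp: basis_of_def R_def)
  have e0: "e0 \<notin> \<uu>" using a(1,3) by simp
  have inu: "b0 \<in> \<uu>" "b1 \<in> \<uu>" "R \<subseteq> \<uu>" using sp by (auto intro: real_vector.span_base)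
  have ind': "independent (insert e0 (insert b0 (insert b1 R)))"
    using ind e0 sp by (simp add: real_vector.independent_insertI)
  have neq: "e0 \<noteq> b0" "e0 \<noteq> b1" "e0 \<notin> R" using e0 inu by auto
  have "b0 \<notin> span (insert e0 (insert b0 (insert b1 R)) - {b0})"
    "b1 \<notin> span (insert e0 (insert b0 (insert b1 R)) - {b1})"
    using ind' unfolding real_vector.dependent_def by auto
  moreover have "insert e0 (insert b0 (insert b1 R)) - {b0} = insert e0 (insert b1 R)"
    "insert e0 (insert b0 (insert b1 R)) - {b1} = insert e0 (insert b0 R)"
    using dist neq by auto
  ultimately have n: "b0 \<notin> span (insert e0 (insert b1 R))" "b1 \<notin> span (insert e0 (insert b0 R))"
    by simp_all
  obtain p :: "'a \<Rightarrow> real" where p: "linear p" "p b0 = 1" "\<And>x. x \<in> span (insert e0 (insert b1 R)) \<Longrightarrow> p x = 0"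
    by (rule separating_functional[OF n(1)]) blast
  obtain q :: "'a \<Rightarrow> real" where q: "linear q" "q b1 = 1" "\<And>x. x \<in> span (insert e0 (insert b0 R)) \<Longrightarrow> q x = 0"
    by (rule separating_functional[OF n(2)]) blast
  have base: "p e0 = 0" "q e0 = 0" "p b1 = 0" "q b0 = 0"
    by (auto intro!: p(3) q(3) real_vector.span_base)
  have onR: "x \<in> span R \<Longrightarrow> p x = 0" "x \<in> span R \<Longrightarrow> q x = 0" for x
    using real_vector.span_mono[of R "insert e0 (insert b1 R)"]
      real_vector.span_mono[of R "insert e0 (insert b0 R)"] p(3) q(3) by blast+
  have "x - a x *\<^sub>R e0 - p x *\<^sub>R b0 - q x *\<^sub>R b1 \<in> span R" for x
  proof -
    have "x - a x *\<^sub>R e0 \<in> span (insert b0 (insert b1 R))" using a(2) sp by simp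
    then obtain c d where w: "x - a x *\<^sub>R e0 - c *\<^sub>R b0 - d *\<^sub>R b1 \<in> span R"
      by (auto simp: real_vector.span_breakdown_eq)
    have "p x = c" "q x = d"
      using onR(1)[OF w] onR(2)[OF w] base p(2) q(2)
      by (simp_all add: linear_diff[OF p(1)] linear_diff[OF q(1)] linear_scale[OF p(1)] linear_scale[OF q(1)])
    then show ?thesis using w by simp
  qed
  then show ?thesis using that[of p q] p q base onR unfolding R_def by blast
qed

context
  fixes br :: "'a::real_vector \<Rightarrow> 'a \<Rightarrow> 'a" and e0 b0 b1 :: 'a and a p q :: "'a \<Rightarrow> real"
    and W :: "'a set" and m :: real and k :: nat
  assumes L: "linear (br e0)"
    and br: "\<And>x y. br x y = a x *\<^sub>R br e0 y - a y *\<^sub>R br e0 x"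
    and lin: "linear a" "linear p" "linear q"
    and vals: "a e0 = 1" "a b0 = 0" "a b1 = 0" "p e0 = 0" "p b0 = 1" "p b1 = 0"
      "q e0 = 0" "q b0 = 0" "q b1 = 1"
    and W: "\<And>x. x \<in> W \<Longrightarrow> a x = 0" "\<And>x. x \<in> W \<Longrightarrow> p x = 0" "\<And>x. x \<in> W \<Longrightarrow> q x = 0"
    and dec: "\<And>x. x - a x *\<^sub>R e0 - p x *\<^sub>R b0 - q x *\<^sub>R b1 \<in> W"
    and Lb: "br e0 b0 = 0" "br e0 b1 = m *\<^sub>R b1"
    and un: "unitary_operator k W (br e0)"
begin

text \<open>The component along \<open>b1\<close> is the only part of ad of \<open>e0\<close> that
  is not skew; after it is split off, what remains factors through the projection onto
  \<open>W\<close>.\<close>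

private lemma plane_sum_projection:
  obtains \<pi> where "linear \<pi>" "\<And>x. \<pi> x \<in> W" "\<And>x. x \<in> W \<Longrightarrow> \<pi> x = x"
    "\<And>x. x = a x *\<^sub>R e0 + p x *\<^sub>R b0 + q x *\<^sub>R b1 + \<pi> x"
    "\<And>x. br e0 x = (m * q x) *\<^sub>R b1 + br e0 (\<pi> x)" "\<And>x. br e0 (\<pi> x) \<in> W"
proof -
  define \<pi> where "\<pi> x = x - a x *\<^sub>R e0 - p x *\<^sub>R b0 - q x *\<^sub>R b1" for x
  have 1: "linear \<pi>" unfolding \<pi>_def
    by (rule linearI) (simp_all add: linear_add[OF lin(1)] linear_scale[OF lin(1)] linear_add[OF lin(2)]
      linear_scale[OF lin(2)] linear_add[OF lin(3)] linear_scale[OF lin(3)] algebra_simps)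
  have "br e0 e0 = 0" using br[of e0 e0] by simp
  then have 5: "br e0 x = (m * q x) *\<^sub>R b1 + br e0 (\<pi> x)" for x
    by (simp add: \<pi>_def linear_diff[OF L] linear_scale[OF L] Lb)
  have 6: "br e0 (\<pi> x) \<in> W" for x
    using un dec[of x] unfolding unitary_operator_def endo_on_def \<pi>_def by blast
  have 2: "\<pi> x \<in> W" and 4: "x = a x *\<^sub>R e0 + p x *\<^sub>R b0 + q x *\<^sub>R b1 + \<pi> x" for x
    using dec[of x] by (simp_all add: \<pi>_def)
  have 3: "\<pi> x = x" if "x \<in> W" for x using W[OF that] by (simp add: \<pi>_def)
  show ?thesis by (rule that[OF 1 2 3 4 5 6])
qed

text \<open>When \<open>m = 0\<close> the operator vanishes on the plane of \<open>b0\<close> and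
  \<open>b1\<close>, so a rotation of this plane commutes with it and completes the complex
  structure of \<open>W\<close>. This turns condition (ii) into membership in u(n).\<close>

lemma unitary_operator_plane_sum:
  assumes "m = 0" "dim \<uu> = 2 * (k + 1)" "subspace \<uu>" "\<And>x. x \<in> \<uu> \<longleftrightarrow> a x = 0"
  shows "unitary_operator (k + 1) \<uu> (br e0)"
proof -
  obtain \<pi> where \<pi>: "linear \<pi>" "\<And>x. \<pi> x \<in> W" "\<And>x. x \<in> W \<Longrightarrow> \<pi> x = x"
    "\<And>x. x = a x *\<^sub>R e0 + p x *\<^sub>R b0 + q x *\<^sub>R b1 + \<pi> x"
    "\<And>x. br e0 x = (m * q x) *\<^sub>R b1 + br e0 (\<pi> x)" "\<And>x. br e0 (\<pi> x) \<in> W"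
    using plane_sum_projection by blast
  obtain K g where K: "linear K" "\<And>x. K x \<in> W" "\<And>x. K (K x) = - \<pi> x" "\<And>x. K (\<pi> x) = K x"
    "\<And>x. K (br e0 (\<pi> x)) = br e0 (K x)"
    and g: "\<And>x y z. g (x + y) z = g x z + g y z" "\<And>c x y. g (c *\<^sub>R x) y = c * g x y"
    "\<And>x y. g x y = g y x" "\<And>x. g x x \<ge> 0" "\<And>x. g x x = 0 \<Longrightarrow> \<pi> x = 0"
    "\<And>x y. g (\<pi> x) y = g x y" "\<And>x y. g (K x) (K y) = g x y"
    "\<And>x y. g (br e0 (\<pi> x)) y = - g x (br e0 (\<pi> y))"
    using unitary_operator_extend[OF un \<pi>(1-3)] by blast
  have L\<pi>: "br e0 (\<pi> x) = br e0 x" for x using \<pi>(5)[of x] assms(1) by simp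
  have LW: "br e0 x \<in> W" for x using \<pi>(6)[of x] L\<pi> by simp
  have \<pi>b: "\<pi> b0 = 0" "\<pi> b1 = 0" using \<pi>(4)[of b0] \<pi>(4)[of b1] by (simp_all add: vals)
  have Kb: "K b0 = 0" "K b1 = 0"
    using K(4)[of b0] K(4)[of b1] by (simp_all add: \<pi>b linear_0[OF K(1)])
  have gr: "g x (c *\<^sub>R y) = c * g x y" "g x (y + z) = g x y + g x z" for c x y z
    using g(1,2,3) by metis+
  have gb: "g b0 x = 0" "g b1 x = 0" "g x b0 = 0" "g x b1 = 0" for x
    using g(6)[of b0 x] g(6)[of b1 x] g(3)[of x] g(2)[of 0 0 x] by (simp_all add: \<pi>b)
  have dec_u: "x = p x *\<^sub>R b0 + q x *\<^sub>R b1 + \<pi> x" if "x \<in> \<uu>" for x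
    using \<pi>(4)[of x] that assms(4) by simp
  define J where "J x = p x *\<^sub>R b1 - q x *\<^sub>R b0 + K x" for x
  define ip where "ip x y = p x * p y + q x * q y + g x y" for x y
  note linears = linear_add[OF lin(1)] linear_scale[OF lin(1)] linear_diff[OF lin(1)]
    linear_add[OF lin(2)] linear_scale[OF lin(2)] linear_diff[OF lin(2)] linear_neg[OF lin(2)]
    linear_add[OF lin(3)] linear_scale[OF lin(3)] linear_diff[OF lin(3)] linear_neg[OF lin(3)]
    linear_add[OF K(1)] linear_scale[OF K(1)] linear_diff[OF K(1)]
    linear_add[OF L] linear_scale[OF L] linear_diff[OF L]
  have pos: "x = 0" if "ip x x \<le> 0" "x \<in> \<uu>" for x
  proof -
    have "p x * p x \<ge> 0" "q x * q x \<ge> 0" "p x * p x + q x * q x + g x x \<le> 0"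
      using that by (simp_all add: ip_def)
    then have "p x * p x = 0" "q x * q x = 0" "g x x = 0" using g(4)[of x] by linarith+
    then show ?thesis using g(5)[of x] dec_u[OF that(2)] by simp
  qed
  have "inner_product_on \<uu> ip"
    unfolding inner_product_on_def not_le[symmetric]
  proof (intro conjI ballI allI impI)
    show "ip x y = ip y x" for x y using g(3)[of x y] by (simp add: ip_def)
  qed (use pos in \<open>auto simp: ip_def g(1,2) linears algebra_simps\<close>)
  moreover have "J x \<in> \<uu>" for x
    unfolding assms(4) by (simp add: J_def linears vals W(1) K(2))
  then have "endo_on \<uu> J"
    by (auto simp: endo_on_def J_def linears algebra_simps)
  moreover have "J (J x) = - x" if "x \<in> \<uu>" for x
    by (subst (2) dec_u[OF that]) (simp add: J_def linears vals W K(2,3) Kb)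
  moreover have "ip (J x) (J y) = ip x y" for x y
    by (simp add: ip_def J_def linears vals W K(2) g(1,2,7) gr gb diff_conv_add_uminus[of _ "_ *\<^sub>R _"]
      scaleR_minus_left[symmetric] del: scaleR_minus_left add_uminus_conv_diff)
  moreover have "ip (br e0 x) y = - ip x (br e0 y)" for x y
    using g(8)[of x y] by (simp add: ip_def W LW L\<pi>)
  moreover have "br e0 (J x) = J (br e0 x)" for x
    using K(5)[of x] by (simp add: J_def linears Lb assms(1) W LW L\<pi>)
  moreover have "endo_on \<uu> (br e0)"
    using LW W(1) assms(4) by (auto simp: endo_on_def linears)
  ultimately show ?thesis
    using assms(2) unfolding unitary_operator_def orthogonal_complex_structure_on_def skew_on_def
    by blast
qed

text \<open>\<open>b0\<close> is central, being in the abelian ideal and killed by ad of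
  \<open>e0\<close>; it splits off as a factor. In the complement, \<open>e0\<close> and
  \<open>b1\<close> span a subalgebra of dimension two, on which nothing can obstruct integrability
  or closedness, and \<open>e0\<close> acts on \<open>W\<close> by a unitary operator.\<close>

lemma cokahler_structure_plane_sum: "\<exists>J \<alpha> ip. cokahler_structure br J b0 \<alpha> ip"
proof -
  obtain \<pi> where \<pi>: "linear \<pi>" "\<And>x. \<pi> x \<in> W" "\<And>x. x \<in> W \<Longrightarrow> \<pi> x = x"
    "\<And>x. x = a x *\<^sub>R e0 + p x *\<^sub>R b0 + q x *\<^sub>R b1 + \<pi> x"
    "\<And>x. br e0 x = (m * q x) *\<^sub>R b1 + br e0 (\<pi> x)" "\<And>x. br e0 (\<pi> x) \<in> W"
    using plane_sum_projection by blast
  obtain K g where K: "linear K" "\<And>x. K x \<in> W" "\<And>x. K (K x) = - \<pi> x" "\<And>x. K (\<pi> x) = K x"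
    "\<And>x. K (br e0 (\<pi> x)) = br e0 (K x)"
    and g: "\<And>x y z. g (x + y) z = g x z + g y z" "\<And>c x y. g (c *\<^sub>R x) y = c * g x y"
    "\<And>x y. g x y = g y x" "\<And>x. g x x \<ge> 0" "\<And>x. g x x = 0 \<Longrightarrow> \<pi> x = 0"
    "\<And>x y. g (\<pi> x) y = g x y" "\<And>x y. g (K x) (K y) = g x y"
    "\<And>x y. g (br e0 (\<pi> x)) y = - g x (br e0 (\<pi> y))"
    using unitary_operator_extend[OF un \<pi>(1-3)] by blast
  define N where "N x = br e0 (\<pi> x)" for x
  have N: "linear N" "N x \<in> W" "K (N x) = br e0 (K x)" "g (N x) y = - g x (N y)" for x y
    using linear_compose[OF \<pi>(1) L] \<pi>(6) K(5) g(8) by (simp_all add: N_def[abs_def] o_def)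
  have \<pi>b: "\<pi> e0 = 0" "\<pi> b0 = 0" "\<pi> b1 = 0"
    using \<pi>(4)[of e0] \<pi>(4)[of b0] \<pi>(4)[of b1] by (simp_all add: vals)
  then have Kb: "K e0 = 0" "K b0 = 0" "K b1 = 0"
    using K(4)[of e0] K(4)[of b0] K(4)[of b1] by (simp_all add: linear_0[OF K(1)])
  have Nb: "N e0 = 0" "N b0 = 0" "N b1 = 0" by (simp_all add: N_def \<pi>b linear_0[OF L])
  have gr: "g x (c *\<^sub>R y) = c * g x y" "g x (y + z) = g x y + g x z" for c x y z
    using g(1,2,3) by metis+
  have gn: "g (- x) y = - g x y" for x y using g(2)[of "-1" x y] by simp
  have gd: "g (x - y) z = g x z - g y z" "g z (x - y) = g z x - g z y" for x y z
    using g(1)[of x "- y" z] gn[of y z] g(3) by (simp, metis diff_conv_add_uminus)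
  have gb: "g e0 x = 0" "g b0 x = 0" "g b1 x = 0" "g x e0 = 0" "g x b0 = 0" "g x b1 = 0" for x
    using g(6)[of e0 x] g(6)[of b0 x] g(6)[of b1 x] g(3)[of x] g(2)[of 0 0 x] by (simp_all add: \<pi>b)
  have gK: "g (K x) y = - g x (K y)" for x y
  proof -
    have "g (K x) y = g (K (K x)) (K y)" by (simp add: g(7))
    then show ?thesis by (simp add: K(3) gn g(6))
  qed
  have NK: "N (K x) = K (N x)" "K (K (N x)) = - N x" for x
    using N(3)[of x] \<pi>(3)[OF K(2)[of x]] K(3)[of "N x"] \<pi>(3)[OF N(2)[of x]] by (simp_all add: N_def)
  have s: "g (K (N x)) y = g (K (N y)) x" for x y
  proof -
    have "g (K (N x)) y = g x (N (K y))" by (simp add: gK N(4))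
    then show ?thesis using NK(1)[of y] g(3)[of x] by simp
  qed
  have brN: "br x y = (m * (a x * q y - a y * q x)) *\<^sub>R b1 + a x *\<^sub>R N y - a y *\<^sub>R N x" for x y
  proof -
    have "br x y = a x *\<^sub>R ((m * q y) *\<^sub>R b1 + N y) - a y *\<^sub>R ((m * q x) *\<^sub>R b1 + N x)"
      using br[of x y] \<pi>(5)[of x] \<pi>(5)[of y] by (simp only: N_def)
    then show ?thesis by (simp add: algebra_simps)
  qed
  \<comment> \<open>\<open>J\<close> sends \<open>e0\<close> to \<open>b1\<close> and
    \<open>b1\<close> to \<open>- e0\<close>, kills \<open>b0\<close>, and is \<open>K\<close> on
    \<open>W\<close>. The metric below makes \<open>e0\<close>, \<open>b0\<close>, \<open>b1\<close>
    orthonormal and orthogonal to \<open>W\<close>, so the 1-form has to be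
    \<open>p\<close>.\<close>
  define J where "J x = a x *\<^sub>R b1 - q x *\<^sub>R e0 + K x" for x
  define ip where "ip x y = a x * a y + p x * p y + q x * q y + g x y" for x y
  note linears = linear_add[OF lin(1)] linear_scale[OF lin(1)] linear_diff[OF lin(1)] linear_neg[OF lin(1)]
    linear_add[OF lin(2)] linear_scale[OF lin(2)] linear_diff[OF lin(2)] linear_neg[OF lin(2)]
    linear_add[OF lin(3)] linear_scale[OF lin(3)] linear_diff[OF lin(3)] linear_neg[OF lin(3)]
    linear_add[OF K(1)] linear_scale[OF K(1)] linear_diff[OF K(1)] linear_neg[OF K(1)]
    linear_add[OF N(1)] linear_scale[OF N(1)] linear_diff[OF N(1)] linear_neg[OF N(1)]
  have pos: "x = 0" if "ip x x \<le> 0" for x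
  proof -
    have "a x * a x \<ge> 0" "p x * p x \<ge> 0" "q x * q x \<ge> 0"
      "a x * a x + p x * p x + q x * q x + g x x \<le> 0"
      using that by (simp_all add: ip_def)
    then have "a x * a x = 0" "p x * p x = 0" "q x * q x = 0" "g x x = 0"
      using g(4)[of x] by linarith+
    then show ?thesis using g(5)[of x] \<pi>(4)[of x] by simp
  qed
  have inner: "inner_product_on UNIV ip"
    unfolding inner_product_on_def not_le[symmetric]
  proof (intro conjI ballI allI impI)
    show "ip x y = ip y x" for x y using g(3)[of x y] by (simp add: ip_def)
  qed (use pos in \<open>auto simp: ip_def g(1,2) linears algebra_simps\<close>)
  have lJ: "linear J" by (rule linearI) (simp_all add: J_def linears algebra_simps)
  note Wvals = W(1)[OF K(2)] W(2)[OF K(2)] W(3)[OF K(2)] W(1)[OF N(2)] W(2)[OF N(2)] W(3)[OF N(2)]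
  have JJ: "J (J x) = - x + p x *\<^sub>R b0" for x
  proof -
    have "J (J x) = - (q x *\<^sub>R b1) - a x *\<^sub>R e0 - \<pi> x"
      by (simp add: J_def linears vals Wvals K(3) Kb)
    also have "\<dots> = - (a x *\<^sub>R e0 + p x *\<^sub>R b0 + q x *\<^sub>R b1 + \<pi> x) + p x *\<^sub>R b0" by simp
    finally show ?thesis using \<pi>(4)[of x] by simp
  qed
  have ipJ: "ip (J x) (J y) = ip x y - p x * p y" for x y
    by (simp add: ip_def J_def linears vals Wvals g(1,2,7) gr gd gb)
  have NJ: "N (J x) = K (N x)" "J (K (N x)) = - N x" "J (N x) = K (N x)" "J b1 = - e0" for x
    by (simp_all add: J_def linears Nb NK Wvals vals Kb)
  have qJ: "a (J x) = - q x" "q (J x) = a x" "p (J x) = 0" for x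
    by (simp_all add: J_def linears vals Wvals)
  have "J e0 = b1" by (simp add: J_def vals Kb)
  then have nij: "nijenhuis br J x y = 0" for x y
    by (simp add: nijenhuis_def brN NJ qJ linear_add[OF lJ] linear_diff[OF lJ] linear_scale[OF lJ]
        linear_neg[OF lJ] algebra_simps)
  have closed: "ce_diff2 br (\<lambda>u v. ip (J u) v) x y z = 0" for x y z
    using s[of x y] s[of x z] s[of y z]
    by (simp add: ce_diff2_def brN NJ linear_add[OF lJ] linear_diff[OF lJ] linear_scale[OF lJ]
        ip_def linears vals Wvals g(1,2) gd gn gb) (simp add: algebra_simps)
  have "cokahler_structure br J b0 p ip"
    unfolding cokahler_structure_def
  proof (intro conjI allI lJ lin vals inner JJ ipJ nij closed)
    show "b0 \<noteq> 0" using vals(5) linear_0[OF lin(2)] by auto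
    show "ce_diff1 br p x y = 0" for x y
      by (simp add: ce_diff1_def brN linears vals Wvals)
  qed
  then show ?thesis by blast
qed

text \<open>The difference \<open>d\<close> of \<open>\<xi>\<close> and \<open>b0\<close> is central
  and \<open>f\<close> vanishes on brackets, so adding \<open>f x *\<^sub>R d\<close> alters neither
  the value of a bracket nor the bracket of two arguments. This map is therefore a homomorphism; it
  is invertible because \<open>f \<xi>\<close> is not zero, and it sends \<open>b0\<close> to
  \<open>\<xi>\<close> because \<open>f b0 = 1\<close>.\<close>

lemma cokahler_structure_kernel:
  assumes \<xi>: "a \<xi> = 0" "br e0 \<xi> = 0" "\<xi> \<noteq> 0"
  shows "\<exists>J \<alpha> ip. cokahler_structure br J \<xi> \<alpha> ip"
proof -
  obtain \<pi> where \<pi>: "linear \<pi>" "\<And>x. \<pi> x \<in> W" "\<And>x. x \<in> W \<Longrightarrow> \<pi> x = x"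
    "\<And>x. x = a x *\<^sub>R e0 + p x *\<^sub>R b0 + q x *\<^sub>R b1 + \<pi> x"
    "\<And>x. br e0 x = (m * q x) *\<^sub>R b1 + br e0 (\<pi> x)" "\<And>x. br e0 (\<pi> x) \<in> W"
    using plane_sum_projection by blast
  obtain K g where K: "linear K" "\<And>x. K x \<in> W" "\<And>x. K (K x) = - \<pi> x" "\<And>x. K (\<pi> x) = K x"
    "\<And>x. K (br e0 (\<pi> x)) = br e0 (K x)"
    and g: "\<And>x y z. g (x + y) z = g x z + g y z" "\<And>c x y. g (c *\<^sub>R x) y = c * g x y"
    "\<And>x y. g x y = g y x" "\<And>x. g x x \<ge> 0" "\<And>x. g x x = 0 \<Longrightarrow> \<pi> x = 0"
    "\<And>x y. g (\<pi> x) y = g x y" "\<And>x y. g (K x) (K y) = g x y"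
    "\<And>x y. g (br e0 (\<pi> x)) y = - g x (br e0 (\<pi> y))"
    using unitary_operator_extend[OF un \<pi>(1-3)] by blast
  have \<pi>b: "\<pi> b0 = 0" "\<pi> b1 = 0" using \<pi>(4)[of b0] \<pi>(4)[of b1] by (simp_all add: vals)
  have g0: "g 0 x = 0" "g x 0 = 0" "g b0 x = 0" "g b1 x = 0" for x
    using g(6)[of b0 x] g(6)[of b1 x] g(3)[of x 0] g(2)[of 0 0 x] by (simp_all add: \<pi>b)
  \<comment> \<open>A kernel vector has a \<open>b1\<close>-coordinate only if
    \<open>m = 0\<close>.\<close>
  have "q (br e0 \<xi>) = m * q \<xi>"
    by (subst \<pi>(5)) (simp add: linear_add[OF lin(3)] linear_scale[OF lin(3)] vals W(3)[OF \<pi>(6)])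
  then have mq: "m * q \<xi> = 0" using \<xi>(2) linear_0[OF lin(3)] by simp
  then have N\<xi>: "br e0 (\<pi> \<xi>) = 0" using \<pi>(5)[of \<xi>] \<xi>(2) unfolding mq by simp
  \<comment> \<open>The second summand of f is needed only when p vanishes at \<open>\<xi>\<close>; it is then positive there.\<close>
  define s :: real where "s = (if p \<xi> = 0 then 1 else 0)"
  define f where "f x = p x + s * (g x \<xi> + q \<xi> * q x)" for x
  have lf: "linear f"
    by (rule linearI)
      (simp_all add: f_def g(1,2) linear_add[OF lin(2)] linear_scale[OF lin(2)] linear_add[OF lin(3)]
        linear_scale[OF lin(3)] algebra_simps)
  have fb: "f b0 = 1" by (simp add: f_def vals g0)
  \<comment> \<open>Skewness moves the operator onto \<open>\<xi>\<close>, where it vanishes; the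
    factor \<open>m\<close> from the \<open>b1\<close>-component meets \<open>q \<xi>\<close>, and
    their product is zero.\<close>
  have fL: "f (br e0 x) = 0" for x
  proof -
    have "f (br e0 x) = s * (- g x (br e0 (\<pi> \<xi>)) + q x * (m * q \<xi>))"
      by (subst \<pi>(5)) (simp add: f_def linear_add[OF lin(2)] linear_scale[OF lin(2)] linear_add[OF lin(3)]
        linear_scale[OF lin(3)] vals W[OF \<pi>(6)] g(1,2,8) g0)
    then show ?thesis by (simp only: mq N\<xi> g0) simp
  qed
  have f\<xi>: "f \<xi> \<noteq> 0"
  proof (cases "p \<xi> = 0")
    case True
    have "g \<xi> \<xi> \<noteq> 0 \<or> q \<xi> * q \<xi> \<noteq> 0" using g(5)[of \<xi>] \<pi>(4)[of \<xi>] True \<xi>(1,3) by auto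
    moreover have "q \<xi> * q \<xi> \<ge> 0" by simp
    ultimately have "g \<xi> \<xi> + q \<xi> * q \<xi> > 0" using g(4)[of \<xi>] by linarith
    then show ?thesis using True by (simp add: f_def s_def)
  qed (simp add: f_def s_def)
  define d where "d = \<xi> - b0"
  have fd: "f d = f \<xi> - 1" by (simp add: d_def linear_diff[OF lf] fb)
  have ad: "a d = 0" "br e0 d = 0"
    by (simp_all add: d_def linear_diff[OF lin(1)] linear_diff[OF L] vals \<xi> Lb)
  define \<phi> where "\<phi> x = x + f x *\<^sub>R d" for x
  \<comment> \<open>Since \<open>f d = f \<xi> - 1\<close>, the map \<open>\<phi>\<close> multiplies
    \<open>f\<close> by \<open>f \<xi>\<close>; dividing by it recovers the multiple of
    \<open>d\<close> to subtract.\<close>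
  define \<psi> where "\<psi> x = x - (f x / f \<xi>) *\<^sub>R d" for x
  have lin': "linear \<phi>" "linear \<psi>"
    by (auto simp: \<phi>_def \<psi>_def linear_add[OF lf] linear_scale[OF lf] algebra_simps add_divide_distrib
        intro!: linearI)
  have f\<phi>: "f (\<phi> x) = f x * f \<xi>" and f\<psi>: "f (\<psi> x) = f x / f \<xi>" for x
    using f\<xi> by (simp_all add: \<phi>_def \<psi>_def linear_add[OF lf] linear_diff[OF lf] linear_scale[OF lf] fd field_simps)
  have "\<phi> (\<psi> x) = \<psi> x + (f x / f \<xi>) *\<^sub>R d" for x by (simp add: \<phi>_def[of "\<psi> x"] f\<psi>)
  then have inv1: "\<phi> (\<psi> x) = x" for x by (simp add: \<psi>_def)
  have "\<psi> (\<phi> x) = \<phi> x - f x *\<^sub>R d" for x using f\<xi> by (simp add: \<psi>_def[of "\<phi> x"] f\<phi>)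
  then have inv2: "\<psi> (\<phi> x) = x" for x by (simp add: \<phi>_def)
  have "f (br x y) = 0" for x y
    by (subst br) (simp add: linear_diff[OF lf] linear_scale[OF lf] fL)
  then have \<phi>br: "\<phi> (br x y) = br x y" for x y by (simp add: \<phi>_def)
  have "a (\<phi> x) = a x" "br e0 (\<phi> x) = br e0 x" for x
    by (simp_all add: \<phi>_def linear_add[OF lin(1)] linear_scale[OF lin(1)] linear_add[OF L]
      linear_scale[OF L] ad)
  then have "\<phi> (br x y) = br (\<phi> x) (\<phi> y)" for x y
    unfolding \<phi>br using br[of "\<phi> x" "\<phi> y"] br[of x y] by simp
  moreover obtain J \<alpha> ip where "cokahler_structure br J b0 \<alpha> ip"
    using cokahler_structure_plane_sum by blast
  ultimately have "cokahler_structure br (\<phi> \<circ> J \<circ> \<psi>) (\<phi> b0) (\<alpha> \<circ> \<psi>) (\<lambda>x y. ip (\<psi> x) (\<psi> y))"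
    by (intro cokahler_structure_transport lin' inv1 inv2)
  moreover have "\<phi> b0 = \<xi>" by (simp add: \<phi>_def fb d_def)
  ultimately show ?thesis by metis
qed

end

section \<open>From unitary matrices to unitary operators\<close>

lemma std_complex_structure_simps:
  "std_complex_structure k \<in> carrier_mat (2 * k) (2 * k)"
  "std_complex_structure k * std_complex_structure k = - 1\<^sub>m (2 * k)"
  "transpose_mat (std_complex_structure k) = - std_complex_structure k"
proof -
  let ?S = "std_complex_structure k"
  show c: "?S \<in> carrier_mat (2 * k) (2 * k)"
    by (auto simp: std_complex_structure_def mult_2)
  have "?S * ?S = four_block_mat (0\<^sub>m k k * 0\<^sub>m k k + (- 1\<^sub>m k) * 1\<^sub>m k) (0\<^sub>m k k * (- 1\<^sub>m k) + (- 1\<^sub>m k) * 0\<^sub>m k k)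
      (1\<^sub>m k * 0\<^sub>m k k + 0\<^sub>m k k * 1\<^sub>m k) (1\<^sub>m k * (- 1\<^sub>m k) + 0\<^sub>m k k * 0\<^sub>m k k)"
    unfolding std_complex_structure_def by (rule mult_four_block_mat) auto
  also have "\<dots> = - 1\<^sub>m (2 * k)" by (rule eq_matI) auto
  finally show "?S * ?S = - 1\<^sub>m (2 * k)" .
  show "transpose_mat ?S = - ?S"
    unfolding std_complex_structure_def
    by (subst transpose_four_block_mat[of _ k k _ k _ k]) (auto intro!: eq_matI)
qed

text \<open>Declare \<open>bs\<close> orthonormal and let the standard complex structure act on
  coordinates: skewness and commutation of the matrix then become those of the operator.\<close>

lemma unitary_operator_of_matrix:
  fixes L :: "'a::real_vector \<Rightarrow> 'a"
  assumes lin: "linear L" and bs: "basis_of bs W" and mat: "matrix_wrt bs L A"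
    and A: "A \<in> unitary_matrices k"
  shows "unitary_operator k W L"
proof -
  define N where "N = 2 * k"
  have AN: "A \<in> carrier_mat N N" and At: "transpose_mat A = - A"
    and AS: "A * std_complex_structure k = std_complex_structure k * A"
    using A by (auto simp: unitary_matrices_def N_def)
  define S where "S = std_complex_structure k"
  note Sfacts = std_complex_structure_simps[of k, folded S_def N_def]
  have len: "length bs = N" using mat AN by (auto simp: matrix_wrt_def)
  have dist: "distinct bs" and ind: "independent (set bs)" and sp: "span (set bs) = W"
    using bs by (auto simp: basis_of_def)
  have Lb: "L (bs ! j) = (\<Sum>i<N. (A $$ (i, j)) *\<^sub>R (bs ! i))" if "j < N" for j
    using mat that len by (simp add: matrix_wrt_def)
  \<comment> \<open>\<open>cv\<close> and \<open>comb\<close> are mutually inverse between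
    \<open>W\<close> and column vectors; every structure on \<open>W\<close> below is pulled back
    along \<open>cv\<close>.\<close>
  define cv where "cv x = vec N (\<lambda>i. representation (set bs) x (bs ! i))" for x
  define comb where "comb v = (\<Sum>i<N. vec_index v i *\<^sub>R (bs ! i))" for v
  have cvN: "cv x \<in> carrier_vec N" for x by (simp add: cv_def)
  have combW: "comb v \<in> W" for v
    unfolding comb_def sp[symmetric]
    by (intro real_vector.span_sum real_vector.span_scale real_vector.span_base) (simp add: len)
  have comb_cv: "comb (cv x) = x" if "x \<in> W" for x
  proof -
    have "comb (cv x) = (\<Sum>i<N. representation (set bs) x (bs ! i) *\<^sub>R (bs ! i))"
      unfolding comb_def by (rule sum.cong) (auto simp: cv_def)
    also have "\<dots> = (\<Sum>b\<in>set bs. representation (set bs) x b *\<^sub>R b)"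
      by (rule sum.reindex_bij_betw[OF bij_betw_nth]) (auto simp: dist len)
    also have "\<dots> = x" using ind that sp by (intro real_vector.sum_representation_eq) auto
    finally show ?thesis .
  qed
  have cv_add: "cv (x + y) = cv x + cv y" if "x \<in> W" "y \<in> W" for x y
    using that ind sp by (auto simp: cv_def real_vector.representation_add intro!: eq_vecI)
  have cv_scale: "cv (c *\<^sub>R x) = c \<cdot>\<^sub>v cv x" if "x \<in> W" for c x
    using that ind sp by (auto simp: cv_def real_vector.representation_scale intro!: eq_vecI)
  have cv_comb: "cv (comb v) = v" if "v \<in> carrier_vec N" for v
  proof (rule eq_vecI)
    fix i assume "i < dim_vec v"
    then have i: "i < N" using that by simp
    have "representation (set bs) (comb v) (bs ! i)
        = (\<Sum>j<N. representation (set bs) (vec_index v j *\<^sub>R (bs ! j)) (bs ! i))"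
      unfolding comb_def using ind
      by (subst real_vector.representation_sum)
        (simp_all add: real_vector.span_scale real_vector.span_base len)
    also have "\<dots> = (\<Sum>j<N. if j = i then vec_index v j else 0)"
    proof (rule sum.cong)
      fix j assume "j \<in> {..<N}"
      then have j: "j < N" by simp
      then have "representation (set bs) (vec_index v j *\<^sub>R (bs ! j)) (bs ! i)
          = vec_index v j * (if bs ! i = bs ! j then 1 else 0)"
        using ind len by (simp add: real_vector.representation_scale real_vector.representation_basis
          real_vector.span_base)
      then show "representation (set bs) (vec_index v j *\<^sub>R (bs ! j)) (bs ! i) = (if j = i then vec_index v j else 0)"
        using nth_eq_iff_index_eq[OF dist, of i j] i j len by auto
    qed simp
    finally show "vec_index (cv (comb v)) i = vec_index v i" using i by (simp add: cv_def)
  qed (use that in \<open>simp add: cv_def\<close>)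
  have comb_add: "comb (v + w) = comb v + comb w" if "v \<in> carrier_vec N" "w \<in> carrier_vec N" for v w
    using that by (simp add: comb_def scaleR_add_left sum.distrib)
  have comb_scale: "comb (c \<cdot>\<^sub>v v) = c *\<^sub>R comb v" if "v \<in> carrier_vec N" for c v
    using that by (simp add: comb_def scaleR_sum_right)
  have cv_L: "L x = comb (A *\<^sub>v cv x)" if "x \<in> W" for x
  proof -
    have "L x = L (comb (cv x))" using comb_cv[OF that] by simp
    also have "\<dots> = (\<Sum>j<N. \<Sum>i<N. (vec_index (cv x) j * A $$ (i, j)) *\<^sub>R (bs ! i))"
      unfolding comb_def linear_sum[OF lin]
      by (rule sum.cong) (simp_all add: linear_scale[OF lin] Lb scaleR_sum_right)
    also have "\<dots> = (\<Sum>i<N. \<Sum>j<N. (vec_index (cv x) j * A $$ (i, j)) *\<^sub>R (bs ! i))"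
      by (rule sum.swap)
    also have "\<dots> = comb (A *\<^sub>v cv x)"
      unfolding comb_def
    proof (rule sum.cong)
      fix i assume "i \<in> {..<N}"
      then have "vec_index (A *\<^sub>v cv x) i = (\<Sum>j<N. vec_index (cv x) j * A $$ (i, j))"
        using AN cvN[of x] by (simp add: scalar_prod_def atLeast0LessThan mult.commute)
      then show "(\<Sum>j<N. (vec_index (cv x) j * A $$ (i, j)) *\<^sub>R (bs ! i)) = vec_index (A *\<^sub>v cv x) i *\<^sub>R (bs ! i)"
        by (simp add: scaleR_sum_left)
    qed simp
    finally show ?thesis .
  qed
  define J where "J x = comb (S *\<^sub>v cv x)" for x
  define ip where "ip x y = scalar_prod (cv x) (cv y)" for x y
  have SN: "S *\<^sub>v v \<in> carrier_vec N" and AvN: "A *\<^sub>v v \<in> carrier_vec N" if "v \<in> carrier_vec N" for v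
    using Sfacts(1) AN that by auto
  have cvJ: "cv (J x) = S *\<^sub>v cv x" for x unfolding J_def by (rule cv_comb[OF SN[OF cvN]])
  have cvL: "cv (L x) = A *\<^sub>v cv x" if "x \<in> W" for x
    unfolding cv_L[OF that] by (rule cv_comb[OF AvN[OF cvN]])
  have JW: "J x \<in> W" for x by (simp add: J_def combW)
  have neg: "(- B) *\<^sub>v v = - (B *\<^sub>v v)" if "B \<in> carrier_mat N N" "v \<in> carrier_vec N" for B :: "real mat" and v
    using that by (intro eq_vecI) auto
  have skew: "scalar_prod (B *\<^sub>v v) w = - scalar_prod v (B *\<^sub>v w)"
    if B: "B \<in> carrier_mat N N" "transpose_mat B = - B" and v: "v \<in> carrier_vec N" "w \<in> carrier_vec N"
    for B :: "real mat" and v w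
  proof -
    have "scalar_prod (transpose_mat B *\<^sub>v v) w = scalar_prod v (B *\<^sub>v w)"
      by (rule transpose_vec_mult_scalar[OF B(1) v(2) v(1)])
    then show ?thesis using B v by (simp add: neg)
  qed
  have SS: "S *\<^sub>v (S *\<^sub>v v) = - v" if "v \<in> carrier_vec N" for v
    using assoc_mult_mat_vec[OF Sfacts(1) Sfacts(1) that] that Sfacts(2) by (simp add: neg)
  have "ip x x > 0" if "x \<in> W" "x \<noteq> 0" for x
  proof -
    have "cv x \<noteq> 0\<^sub>v N" using comb_cv[OF that(1)] that(2) by (auto simp: comb_def)
    moreover have "cv x = 0\<^sub>v N" if "\<forall>i<N. vec_index (cv x) i = 0"
      by (rule eq_vecI) (use that cvN[of x] in auto)
    ultimately obtain i where i: "i < N" "vec_index (cv x) i \<noteq> 0" by blast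
    have "0 < (\<Sum>i<N. vec_index (cv x) i * vec_index (cv x) i)"
      by (rule sum_pos2[of _ i]) (use i in \<open>auto simp: zero_less_mult_iff\<close>)
    then show ?thesis using cvN[of x] by (simp add: ip_def scalar_prod_def atLeast0LessThan)
  qed
  then have "inner_product_on W ip"
    unfolding inner_product_on_def
  proof (intro conjI ballI allI impI)
    show "ip x y = ip y x" for x y unfolding ip_def by (rule comm_scalar_prod[OF cvN cvN])
  qed (simp_all add: ip_def cv_add cv_scale add_scalar_prod_distrib[OF cvN cvN cvN]
      smult_scalar_prod_distrib[OF cvN cvN])
  moreover have "orthogonal_complex_structure_on W ip J"
    unfolding orthogonal_complex_structure_on_def endo_on_def
  proof (intro conjI ballI allI JW)
    fix x y c assume x: "x \<in> W"
    show "J (c *\<^sub>R x) = c *\<^sub>R J x"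
      using Sfacts(1) cvN x by (simp add: J_def cv_scale comb_scale[OF SN] mult_mat_vec[of _ N N])
    show "J (J x) = - x"
    proof -
      have "J (J x) = comb ((-1) \<cdot>\<^sub>v cv x)"
        unfolding J_def[of "J x"] cvJ SS[OF cvN] by (rule arg_cong[of _ _ comb]) auto
      then show ?thesis by (simp add: comb_scale[OF cvN] comb_cv[OF x])
    qed
    assume y: "y \<in> W"
    show "J (x + y) = J x + J y"
      using Sfacts(1) cvN x y SN by (simp add: J_def cv_add comb_add mult_add_distrib_mat_vec[of _ N N])
    show "ip (J x) (J y) = ip x y"
      using skew[OF Sfacts(1,3) cvN SN[OF cvN], of x y] cvN[of x] cvN[of y]
      by (simp add: ip_def cvJ SS)
  qed
  moreover have "skew_on W ip L"
    using skew[OF AN At cvN cvN] by (auto simp: skew_on_def ip_def cvL)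
  moreover have "L (J x) = J (L x)" if "x \<in> W" for x
    using cv_L[OF JW] assoc_mult_mat_vec[OF AN Sfacts(1) cvN[of x]]
      assoc_mult_mat_vec[OF Sfacts(1) AN cvN[of x]] AS
    by (simp add: cvJ J_def[of "L x"] cvL[OF that] S_def[symmetric])
  moreover have "endo_on W L"
    using cv_L combW lin by (auto simp: endo_on_def linear_add linear_scale)
  moreover have "dim W = 2 * k"
    using real_vector.dim_span_eq_card_independent[OF ind] sp distinct_card[OF dist] len by (simp add: N_def)
  ultimately show ?thesis unfolding unitary_operator_def by blast
qed

text \<open>Column j holds the coordinates of the image of the j-th basis vector, so a
  block-diagonal matrix makes the three pieces invariant. Allowing \<open>m\<close> to be 0 covers
  (ii) and (iii) at once.\<close>

lemma matrix_wrt_diag_block: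
  fixes f :: "'a::real_vector \<Rightarrow> 'a"
  assumes mat: "matrix_wrt bs f (diag_block_mat [0\<^sub>m 1 1, m \<cdot>\<^sub>m 1\<^sub>m 1, A])"
    and A: "A \<in> carrier_mat N N"
  obtains b0 b1 rs where "bs = b0 # b1 # rs" "f b0 = 0" "f b1 = m *\<^sub>R b1" "matrix_wrt rs f A"
proof -
  define D where "D = diag_block_mat [0\<^sub>m 1 1, m \<cdot>\<^sub>m 1\<^sub>m 1, A]"
  have D: "D \<in> carrier_mat (Suc (Suc N)) (Suc (Suc N))"
    using A by (auto simp: D_def Let_def)
  have len: "length bs = Suc (Suc N)" using mat[folded D_def] D by (auto simp: matrix_wrt_def)
  then obtain b0 b1 rs where bs: "bs = b0 # b1 # rs" and rs: "length rs = N"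
    by (auto simp: length_Suc_conv)
  have ent: "D $$ (0, 0) = 0" "D $$ (1, 0) = 0" "D $$ (0, 1) = 0" "D $$ (1, 1) = m"
    "j < N \<Longrightarrow> D $$ (Suc (Suc j), 0) = 0" "j < N \<Longrightarrow> D $$ (Suc (Suc j), 1) = 0"
    "j < N \<Longrightarrow> D $$ (0, Suc (Suc j)) = 0" "j < N \<Longrightarrow> D $$ (1, Suc (Suc j)) = 0"
    "i < N \<Longrightarrow> j < N \<Longrightarrow> D $$ (Suc (Suc i), Suc (Suc j)) = A $$ (i, j)" for i j
    using A by (auto simp: D_def Let_def)
  have f: "f (bs ! j) = D $$ (0, j) *\<^sub>R b0 + D $$ (1, j) *\<^sub>R b1
      + (\<Sum>i<N. D $$ (Suc (Suc i), j) *\<^sub>R (rs ! i))" if "j < Suc (Suc N)" for j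
    using mat[folded D_def] that len unfolding matrix_wrt_def
    by (simp add: sum.lessThan_Suc_shift bs del: sum.lessThan_Suc)
  have "f b0 = 0" using f[of 0] by (simp add: bs ent[unfolded One_nat_def])
  moreover have "f b1 = m *\<^sub>R b1" using f[of 1] by (simp add: bs ent[unfolded One_nat_def])
  moreover have "matrix_wrt rs f A"
    unfolding matrix_wrt_def
  proof (intro conjI allI impI)
    show "A \<in> carrier_mat (length rs) (length rs)" using A rs by simp
    fix j assume "j < length rs"
    then show "f (rs ! j) = (\<Sum>i<length rs. A $$ (i, j) *\<^sub>R (rs ! i))"
      using f[of "Suc (Suc j)"] rs by (simp add: bs ent[unfolded One_nat_def])
  qed
  ultimately show ?thesis using that bs by blast
qed

text \<open>The same inner product and complex structure serve. With \<open>t = 1\<close> it passes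
  between \<open>br e0\<close> and \<open>M\<close>, which agree on the ideal only.\<close>

lemma unitary_operator_scale:
  assumes un: "unitary_operator k V L" and L': "\<And>x. x \<in> V \<Longrightarrow> L' x = t *\<^sub>R L x" and V: "subspace V"
  shows "unitary_operator k V L'"
proof -
  obtain h J where dim: "dim V = 2 * k" and endo: "endo_on V L" and ip: "inner_product_on V h"
    and J: "orthogonal_complex_structure_on V h J" and sk: "skew_on V h L"
    and com: "\<And>x. x \<in> V \<Longrightarrow> L (J x) = J (L x)"
    using un unfolding unitary_operator_def by blast
  have LV: "x \<in> V \<Longrightarrow> L x \<in> V" for x using endo unfolding endo_on_def by blast
  have JV: "x \<in> V \<Longrightarrow> J x \<in> V" and Jc: "x \<in> V \<Longrightarrow> J (c *\<^sub>R x) = c *\<^sub>R J x" for x c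
    using J unfolding orthogonal_complex_structure_on_def endo_on_def by blast+
  have hc: "x \<in> V \<Longrightarrow> y \<in> V \<Longrightarrow> h (c *\<^sub>R x) y = c * h x y" for x y c
    using ip unfolding inner_product_on_def by auto
  have sym: "x \<in> V \<Longrightarrow> y \<in> V \<Longrightarrow> h x y = h y x" for x y
    using ip unfolding inner_product_on_def by blast
  have "endo_on V L'"
    using endo V by (simp add: endo_on_def L' subspace_add subspace_scale scaleR_add_right)
  moreover have "skew_on V h L'"
    unfolding skew_on_def
  proof (intro ballI)
    fix x y assume xy: "x \<in> V" "y \<in> V"
    have "h (L' x) y = t * h (L x) y" using xy by (simp add: L' hc LV)
    also have "h (L x) y = - h x (L y)" using sk xy unfolding skew_on_def by blast
    also have "h x (L y) = h (L y) x" by (rule sym[OF xy(1) LV[OF xy(2)]])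
    also have "t * - h (L y) x = - h (L' y) x" using xy by (simp add: L' hc LV)
    also have "h (L' y) x = h x (L' y)"
      using xy V LV by (intro sym) (auto simp: L' subspace_scale)
    finally show "h (L' x) y = - h x (L' y)" .
  qed
  moreover have "L' (J x) = J (L' x)" if "x \<in> V" for x
    using that by (simp add: L' JV com Jc LV)
  ultimately show ?thesis unfolding unitary_operator_def using dim ip J by blast
qed

text \<open>An injective map sends a basis to an independent set of the same size. In case (i) it
  shows that brackets span the ideal.\<close>

lemma injective_endomorphism_spans:
  fixes V :: "'a::real_vector set"
  assumes fin: "dim (UNIV :: 'a set) > 0" and V: "subspace V" and L: "linear L"
    and LV: "\<And>x. x \<in> V \<Longrightarrow> L x \<in> V" and inj: "\<And>x. x \<in> V \<Longrightarrow> L x = 0 \<Longrightarrow> x = 0"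
  shows "V \<subseteq> span (L ` V)"
proof -
  obtain T :: "'a set" where T: "independent T" "UNIV \<subseteq> span T" "card T = dim (UNIV :: 'a set)"
    using real_vector.basis_exists[of UNIV] by metis
  have fT: "finite T" using T(3) fin by (intro card_ge_0_finite) simp
  obtain B where B: "B \<subseteq> V" "independent B" "V \<subseteq> span B"
    by (rule real_vector.basis_exists)
  have fB: "finite B" using real_vector.independent_span_bound[OF fT B(2)] T(2) by auto
  have sB: "span B = V"
    using B V by (metis real_vector.span_minimal subset_antisym)
  have injV: "inj_on L (span B)"
  proof (rule inj_onI)
    fix x y assume "x \<in> span B" "y \<in> span B" "L x = L y"
    then show "x = y" using inj[of "x - y"] V sB by (simp add: linear_diff[OF L] subspace_diff)
  qed
  have "independent (L ` B)" using linear_independent_injective_image[OF L B(2) injV] .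
  moreover have "card (L ` B) = card B"
    using inj_on_subset[OF injV] B sB by (intro card_image) auto
  moreover have "L ` B \<subseteq> span B" using LV B sB by auto
  ultimately have "span B \<subseteq> span (L ` B)"
    using subset_span_if_card_le[OF fB] by simp
  then show ?thesis using sB real_vector.span_mono[of "L ` B" "L ` V"] B(1) by blast
qed

section \<open>Constructions and obstructions in an almost abelian algebra\<close>

context
  fixes br :: "'a::real_vector \<Rightarrow> 'a \<Rightarrow> 'a" and e0 :: 'a and \<uu> :: "'a set" and M :: "'a \<Rightarrow> 'a" and n :: nat
    and a :: "'a \<Rightarrow> real"
  assumes ab: "almost_abelian br e0 \<uu> M" and dim: "dim (UNIV :: 'a set) = 2 * n + 1"
    and a: "linear a" "a e0 = 1" "\<And>x. x \<in> \<uu> \<longleftrightarrow> a x = 0" "\<And>x. x - a x *\<^sub>R e0 \<in> \<uu>"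
    and br: "\<And>x y. br x y = a x *\<^sub>R br e0 y - a y *\<^sub>R br e0 x"
begin

lemma ad_linear: "linear (br x)"
  using ab unfolding almost_abelian_def lie_algebra_def bilinear_def by blast

lemma almost_abelian_ideal: "subspace \<uu>" "dim \<uu> = 2 * n" "x \<in> \<uu> \<Longrightarrow> M x = br e0 x" "br e0 x \<in> \<uu>" "br e0 e0 = 0"
proof -
  show "subspace \<uu>" "dim \<uu> = 2 * n" "x \<in> \<uu> \<Longrightarrow> M x = br e0 x"
    using ab dim unfolding almost_abelian_def by auto
  show e0: "br e0 e0 = 0" using br[of e0 e0] by simp
  have "br e0 (x - a x *\<^sub>R e0) \<in> \<uu>" using ab a(4) unfolding almost_abelian_def by blast
  then show "br e0 x \<in> \<uu>" by (simp add: linear_diff[OF ad_linear] linear_scale[OF ad_linear] e0)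
qed

lemma ker_on_ideal: "x \<in> ker_on \<uu> M \<longleftrightarrow> a x = 0 \<and> br e0 x = 0"
  using a(3) almost_abelian_ideal(3)[of x] by (auto simp: ker_on_def)

text \<open>Because the ideal is abelian, \<open>w\<close> does not affect ad of the new vector on
  it: the restriction is \<open>t\<close> times \<open>M\<close>, again unitary.\<close>

lemma cokahler_structure_off_ideal:
  assumes un: "unitary_operator n \<uu> M" and t: "t \<noteq> 0" and w: "w \<in> \<uu>"
  shows "\<exists>J \<alpha> ip. cokahler_structure br J (t *\<^sub>R e0 + w) \<alpha> ip"
proof -
  define \<xi> where "\<xi> = t *\<^sub>R e0 + w"
  have a\<xi>: "a \<xi> = t" using w a by (simp add: \<xi>_def linear_add[OF a(1)] linear_scale[OF a(1)])
  have br\<xi>: "br \<xi> y = t *\<^sub>R br e0 y - a y *\<^sub>R br e0 \<xi>" for y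
    using br[of \<xi> y] a\<xi> by simp
  have un': "unitary_operator n \<uu> (br \<xi>)"
    by (rule unitary_operator_scale[OF un _ almost_abelian_ideal(1), of _ t])
      (simp add: br\<xi> a(3) almost_abelian_ideal(3))
  show ?thesis
    unfolding \<xi>_def[symmetric]
  proof (rule cokahler_structure_semidirect[where a = "\<lambda>x. a x / t" and \<uu> = \<uu> and k = n])
    show "linear (br \<xi>)" "unitary_operator n \<uu> (br \<xi>)" by (rule ad_linear un')+
    show "linear (\<lambda>x. a x / t)"
      by (rule linearI) (simp_all add: linear_add[OF a(1)] linear_scale[OF a(1)] add_divide_distrib)
    show "a \<xi> / t = 1" using a\<xi> t by simp
    show "a x / t = 0" if "x \<in> \<uu>" for x using that a(3) by simp
    show "x - (a x / t) *\<^sub>R \<xi> \<in> \<uu>" for x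
      using t by (simp add: a(3) linear_diff[OF a(1)] linear_scale[OF a(1)] a\<xi>)
    \<comment> \<open>Rescaling \<open>a\<close> by \<open>t\<close> normalises it at
      \<open>\<xi>\<close>; the two terms in \<open>br e0 \<xi>\<close> cancel.\<close>
    have "(a x / t) *\<^sub>R br \<xi> y - (a y / t) *\<^sub>R br \<xi> x = a x *\<^sub>R br e0 y - a y *\<^sub>R br e0 x" for x y
      unfolding br\<xi> using t by (simp add: algebra_simps)
    then show "br x y = (a x / t) *\<^sub>R br \<xi> y - (a y / t) *\<^sub>R br \<xi> x" for x y
      using br[of x y] by metis
  qed
qed

text \<open>Common ground of (ii), where \<open>m = 0\<close>, and (iii). The kernel vector
  \<open>b0\<close> gives existence, and the eigenvector \<open>b1\<close> later excludes a Reeb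
  vector outside the ideal in (iii).\<close>

lemma diag_block_cokahler:
  assumes bs: "basis_of bs \<uu>" and Mt: "Mt \<in> unitary_matrices (n - 1)" and n: "n \<ge> 1"
    and mat: "matrix_wrt bs M (diag_block_mat [0\<^sub>m 1 1, m \<cdot>\<^sub>m 1\<^sub>m 1, Mt])"
  shows "\<xi> \<in> ker_on \<uu> M \<Longrightarrow> \<xi> \<noteq> 0 \<Longrightarrow> \<exists>J \<alpha> ip. cokahler_structure br J \<xi> \<alpha> ip"
    and "m = 0 \<Longrightarrow> unitary_operator n \<uu> M"
    and "\<exists>b0\<in>ker_on \<uu> M. b0 \<noteq> 0"
    and "\<exists>b1\<in>\<uu>. b1 \<noteq> 0 \<and> M b1 = m *\<^sub>R b1"
proof -
  have inu: "set bs \<subseteq> \<uu>" and ind: "independent (set bs)" and dist: "distinct bs"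
    using bs by (auto simp: basis_of_def intro: real_vector.span_base)
  have "matrix_wrt bs (br e0) (diag_block_mat [0\<^sub>m 1 1, m \<cdot>\<^sub>m 1\<^sub>m 1, Mt])"
    using mat inu almost_abelian_ideal(3) unfolding matrix_wrt_def by (metis nth_mem subsetD)
  moreover have "Mt \<in> carrier_mat (2 * (n - 1)) (2 * (n - 1))" using Mt by (simp add: unitary_matrices_def)
  ultimately obtain b0 b1 rs where bs_eq: "bs = b0 # b1 # rs" and Lb: "br e0 b0 = 0" "br e0 b1 = m *\<^sub>R b1"
    and rs: "matrix_wrt rs (br e0) Mt"
    by (rule matrix_wrt_diag_block)
  have "basis_of rs (span (set rs))"
    using ind dist real_vector.independent_mono[of "set bs" "set rs"]
    by (auto simp: basis_of_def bs_eq)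
  then have un: "unitary_operator (n - 1) (span (set rs)) (br e0)"
    using unitary_operator_of_matrix[OF ad_linear _ rs Mt] by blast
  obtain p q where pq: "linear p" "linear q" "p e0 = 0" "q e0 = 0"
    "p b0 = 1" "p b1 = 0" "q b0 = 0" "q b1 = 1"
    "\<And>x. x \<in> span (set rs) \<Longrightarrow> p x = 0" "\<And>x. x \<in> span (set rs) \<Longrightarrow> q x = 0"
    "\<And>x. x - a x *\<^sub>R e0 - p x *\<^sub>R b0 - q x *\<^sub>R b1 \<in> span (set rs)"
    using basis_coordinates[OF a(3,4,2) bs[unfolded bs_eq]] by blast
  have b: "b0 \<in> \<uu>" "b1 \<in> \<uu>" using inu bs_eq by auto
  then have ab01: "a b0 = 0" "a b1 = 0" using a(3) by auto
  have aW: "a x = 0" if "x \<in> span (set rs)" for x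
    using that real_vector.span_mono[of "set rs" "set bs"] bs a(3) bs_eq
    by (auto simp: basis_of_def)
  note ctx = ad_linear br a(1) pq(1,2) a(2) ab01 pq(3,5,6,4,7,8) aW pq(9,10,11) Lb un
  show "\<exists>J \<alpha> ip. cokahler_structure br J \<xi> \<alpha> ip" if "\<xi> \<in> ker_on \<uu> M" "\<xi> \<noteq> 0"
    using cokahler_structure_kernel[OF ctx, of \<xi>] that ker_on_ideal by blast
  show "unitary_operator n \<uu> M" if "m = 0"
  proof -
    \<comment> \<open>Subtraction on naturals truncates; \<open>n \<ge> 1\<close> makes this
      \<open>n\<close>.\<close>
    have "unitary_operator (n - 1 + 1) \<uu> (br e0)"
      using unitary_operator_plane_sum[OF ctx that _ almost_abelian_ideal(1) a(3)] almost_abelian_ideal(2) n by simp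
    then show ?thesis
      using unitary_operator_scale[of n \<uu> "br e0" M 1] almost_abelian_ideal(1,3) n by simp
  qed
  have nz: "b0 \<noteq> 0" "b1 \<noteq> 0" using pq(5,8) linear_0[OF pq(1)] linear_0[OF pq(2)] by auto
  show "\<exists>b0\<in>ker_on \<uu> M. b0 \<noteq> 0" using nz(1) ab01 Lb ker_on_ideal by blast
  show "\<exists>b1\<in>\<uu>. b1 \<noteq> 0 \<and> M b1 = m *\<^sub>R b1" using nz(2) b(2) Lb(2) almost_abelian_ideal(3) by metis
qed

text \<open>Skewness turns the squared norm of \<open>br e0 \<xi>\<close> into the product of
  \<open>e0\<close> with the image of a vector of the ideal. Only this image has to be orthogonal to
  \<open>e0\<close>: in (ii) it stays in the ideal, in (iii) it is zero.\<close>

lemma cokahler_br_e0_zero: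
  assumes ck: "cokahler_structure br J \<xi> \<alpha> ip" and orth: "\<And>y. y \<in> \<uu> \<Longrightarrow> ip e0 (br \<xi> y) = 0"
  shows "br e0 \<xi> = 0"
proof -
  have lie: "lie_algebra br" using ab unfolding almost_abelian_def by blast
  have "br \<xi> e0 = - br e0 \<xi>" using br[of \<xi> e0] almost_abelian_ideal(5) a(2) by simp
  moreover have "ip (br \<xi> e0) (br e0 \<xi>) = - ip e0 (br \<xi> (br e0 \<xi>))"
    by (rule cokahler_ad_skew[OF ck lie])
  ultimately have "ip (br e0 \<xi>) (br e0 \<xi>) = 0"
    using orth[OF almost_abelian_ideal(4)] cokahler_ip(5)[OF ck] by simp
  then show ?thesis using cokahler_ip(8)[OF ck] by blast
qed

end

section \<open>Existence and exhaustion in the three cases\<close>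

theorem theorem4p10:
  fixes br :: "'a::real_vector \<Rightarrow> 'a \<Rightarrow> 'a"
    and e0 :: 'a and \<uu> :: "'a set" and M :: "'a \<Rightarrow> 'a" and n :: nat
  assumes "almost_abelian br e0 \<uu> M"
    and "dim (UNIV :: 'a set) = 2 * n + 1"
  shows
    "(cond_i n \<uu> M \<or> cond_ii n \<uu> M \<or> cond_iii n \<uu> M \<longrightarrow>
        (\<exists>\<xi> \<hh> D. cokahler_triple br \<xi> \<hh> D)) \<and>
     (cond_i n \<uu> M \<longrightarrow>
        (\<forall>t w. t \<noteq> 0 \<and> w \<in> \<uu> \<longrightarrow>
           (\<exists>J \<alpha> ip. cokahler_structure br J (t *\<^sub>R e0 + w) \<alpha> ip)) \<and>
        (\<forall>J \<xi> \<alpha> ip. cokahler_structure br J \<xi> \<alpha> ip \<longrightarrow>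
           (\<exists>t w. t \<noteq> 0 \<and> w \<in> \<uu> \<and> \<xi> = t *\<^sub>R e0 + w))) \<and>
     (cond_ii n \<uu> M \<longrightarrow>
        (\<forall>\<delta>1 \<delta>2 u0. u0 \<in> ker_on \<uu> M \<and> \<delta>1 *\<^sub>R e0 + \<delta>2 *\<^sub>R u0 \<noteq> 0 \<longrightarrow>
           (\<exists>J \<alpha> ip. cokahler_structure br J (\<delta>1 *\<^sub>R e0 + \<delta>2 *\<^sub>R u0) \<alpha> ip)) \<and>
        (\<forall>J \<xi> \<alpha> ip. cokahler_structure br J \<xi> \<alpha> ip \<and>
           ip e0 e0 = 1 \<and> (\<forall>x\<in>\<uu>. ip e0 x = 0) \<longrightarrow>
           (\<exists>\<delta>1 \<delta>2 u0. u0 \<in> ker_on \<uu> M \<and> \<xi> = \<delta>1 *\<^sub>R e0 + \<delta>2 *\<^sub>R u0 \<and> \<xi> \<noteq> 0))) \<and>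
     (cond_iii n \<uu> M \<longrightarrow>
        (\<forall>\<xi>. \<xi> \<in> ker_on \<uu> M \<and> \<xi> \<noteq> 0 \<longrightarrow>
           (\<exists>J \<alpha> ip. cokahler_structure br J \<xi> \<alpha> ip \<and> ip \<xi> \<xi> = 1)) \<and>
        (\<forall>J \<xi> \<alpha> ip. cokahler_structure br J \<xi> \<alpha> ip \<longrightarrow>
           \<xi> \<in> ker_on \<uu> M \<and> ip \<xi> \<xi> = 1))"
proof -
  obtain a where a: "linear a" "a e0 = 1" "\<And>x. x \<in> \<uu> \<longleftrightarrow> a x = 0" "\<And>x. x - a x *\<^sub>R e0 \<in> \<uu>"
    and br: "\<And>x y. br x y = a x *\<^sub>R br e0 y - a y *\<^sub>R br e0 x"
    using almost_abelian_functional[OF assms(1)] by metis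
  note ctx = assms a br
  note ideal = almost_abelian_ideal[OF ctx]
  have lie: "lie_algebra br" using assms(1) unfolding almost_abelian_def by blast
  have sc: "c *\<^sub>R x \<in> ker_on \<uu> M" if "x \<in> ker_on \<uu> M" for c x
    using that unfolding ker_on_ideal[OF ctx]
    by (simp add: linear_scale[OF a(1)] linear_scale[OF ad_linear[OF ctx]])
  have br_ideal: "br \<xi> y = a \<xi> *\<^sub>R br e0 y" if "y \<in> \<uu>" for \<xi> y
    using br[of \<xi> y] that a(3) by simp
  have dec: "\<xi> = a \<xi> *\<^sub>R e0 + (\<xi> - a \<xi> *\<^sub>R e0)" for \<xi> by simp
  have i_un: "unitary_operator n \<uu> M" if "cond_i n \<uu> M" using that by (simp add: cond_i_def)
  \<comment> \<open>The zero block is rewritten as a zero multiple of the identity, the shape shared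
    with (iii).\<close>
  have ii: "n \<ge> 1 \<and> (\<exists>bs. \<exists>Mt\<in>unitary_matrices (n - 1). basis_of bs \<uu> \<and>
      matrix_wrt bs M (diag_block_mat [0\<^sub>m 1 1, 0 \<cdot>\<^sub>m 1\<^sub>m 1, Mt]))" if "cond_ii n \<uu> M"
  proof -
    have "(0 :: real) \<cdot>\<^sub>m 1\<^sub>m 1 = 0\<^sub>m 1 1" by (rule eq_matI) auto
    then show ?thesis using that unfolding cond_ii_def by simp
  qed
  have ii_un: "unitary_operator n \<uu> M" if "cond_ii n \<uu> M"
    using ii[OF that] diag_block_cokahler(2)[OF ctx] by blast
  have kernel: "\<exists>J \<alpha> ip. cokahler_structure br J \<xi> \<alpha> ip"
    if "cond_ii n \<uu> M \<or> cond_iii n \<uu> M" "\<xi> \<in> ker_on \<uu> M" "\<xi> \<noteq> 0" for \<xi>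
    using that(1)
  proof
    assume "cond_ii n \<uu> M"
    then show ?thesis using ii diag_block_cokahler(1)[OF ctx] that(2,3) by blast
  next
    assume "cond_iii n \<uu> M"
    then show ?thesis
      using diag_block_cokahler(1)[OF ctx] that(2,3) unfolding cond_iii_def by blast
  qed
  have "\<exists>J \<xi> \<alpha> ip. cokahler_structure br J \<xi> \<alpha> ip"
    if "cond_i n \<uu> M \<or> cond_ii n \<uu> M \<or> cond_iii n \<uu> M"
  \<comment> \<open>In (iii) a nonzero kernel vector serves as \<open>\<xi>\<close>; in the other
    two cases \<open>\<xi> = e0\<close> does.\<close>
  proof (cases "cond_iii n \<uu> M")
    case True
    then have "\<exists>b0\<in>ker_on \<uu> M. b0 \<noteq> 0"
      using diag_block_cokahler(3)[OF ctx] unfolding cond_iii_def by blast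
    then show ?thesis using kernel True by blast
  next
    case False
    then have "unitary_operator n \<uu> M" using that i_un ii_un by blast
    then show ?thesis
      using cokahler_structure_off_ideal[OF ctx, of 1 0] subspace_0[OF ideal(1)] by force
  qed
  then have part0: "cond_i n \<uu> M \<or> cond_ii n \<uu> M \<or> cond_iii n \<uu> M \<longrightarrow> (\<exists>\<xi> \<hh> D. cokahler_triple br \<xi> \<hh> D)"
    using cokahler_triple_ad[OF _ lie] by blast
  have part1: "\<exists>t w. t \<noteq> 0 \<and> w \<in> \<uu> \<and> \<xi> = t *\<^sub>R e0 + w"
    if "cond_i n \<uu> M" and ck: "cokahler_structure br J \<xi> \<alpha> ip" for J \<xi> \<alpha> ip
  proof -
    have inj: "x = 0" if "x \<in> \<uu>" "br e0 x = 0" for x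
      using that \<open>cond_i n \<uu> M\<close> ker_on_ideal[OF ctx, of x] a(3) unfolding cond_i_def by blast
    have sub: "\<uu> \<subseteq> span (br e0 ` \<uu>)"
      by (rule injective_endomorphism_spans[OF _ ideal(1) ad_linear[OF ctx] ideal(4) inj])
        (simp add: assms(2))
    \<comment> \<open>A closed 1-form vanishes on brackets, and these span the ideal; since
      \<open>\<alpha> \<xi> = 1\<close>, the vector \<open>\<xi>\<close> cannot lie in it.\<close>
    have "\<alpha> x = 0" if "x \<in> \<uu>" for x
      by (rule linear_eq_0_on_span[OF cokahler_linear(2)[OF ck], of "br e0 ` \<uu>"])
        (use sub that cokahler_alpha_br[OF ck] in auto)
    then have "a \<xi> \<noteq> 0" using cokahler_alpha_xi[OF ck] a(3) by force
    then show ?thesis using dec[of \<xi>] a(4)[of \<xi>] by blast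
  qed
  have part2a: "\<exists>J \<alpha> ip. cokahler_structure br J (\<delta>1 *\<^sub>R e0 + \<delta>2 *\<^sub>R u0) \<alpha> ip"
    if c: "cond_ii n \<uu> M" and u0: "u0 \<in> ker_on \<uu> M" and nz: "\<delta>1 *\<^sub>R e0 + \<delta>2 *\<^sub>R u0 \<noteq> 0" for \<delta>1 \<delta>2 u0
  proof (cases "\<delta>1 = 0")
    case True
    then have "\<delta>2 *\<^sub>R u0 \<noteq> 0" using nz by simp
    then have "\<exists>J \<alpha> ip. cokahler_structure br J (\<delta>2 *\<^sub>R u0) \<alpha> ip" by (rule kernel[OF disjI1[OF c] sc[OF u0]])
    then show ?thesis by (simp only: True scaleR_zero_left add_0_left)
  next
    case False
    show ?thesis
      by (rule cokahler_structure_off_ideal[OF ctx ii_un[OF c] False])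
        (use sc[OF u0, of \<delta>2] in \<open>simp add: ker_on_def\<close>)
  qed
  have part2b: "\<exists>\<delta>1 \<delta>2 u0. u0 \<in> ker_on \<uu> M \<and> \<xi> = \<delta>1 *\<^sub>R e0 + \<delta>2 *\<^sub>R u0 \<and> \<xi> \<noteq> 0"
    if ck: "cokahler_structure br J \<xi> \<alpha> ip" and orth: "\<forall>x\<in>\<uu>. ip e0 x = 0" for J \<xi> \<alpha> ip
  proof -
    have "br \<xi> y \<in> \<uu>" if "y \<in> \<uu>" for y
      using br_ideal[OF that, of \<xi>] subspace_scale[OF ideal(1) ideal(4)] by simp
    then have "br e0 \<xi> = 0" using cokahler_br_e0_zero[OF ctx ck] orth by blast
    then have "br e0 (\<xi> - a \<xi> *\<^sub>R e0) = 0"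
      by (simp add: linear_diff[OF ad_linear[OF ctx]] linear_scale[OF ad_linear[OF ctx]] ideal(5))
    then have "\<xi> - a \<xi> *\<^sub>R e0 \<in> ker_on \<uu> M" using a(3,4) ker_on_ideal[OF ctx] by blast
    \<comment> \<open>The part of \<open>\<xi>\<close> in the ideal is itself the kernel vector, so
      its coefficient can be 1.\<close>
    moreover have "\<xi> = a \<xi> *\<^sub>R e0 + 1 *\<^sub>R (\<xi> - a \<xi> *\<^sub>R e0)" by simp
    moreover have "\<xi> \<noteq> 0" using ck unfolding cokahler_structure_def by blast
    ultimately show ?thesis by blast
  qed
  have part3: "\<xi> \<in> ker_on \<uu> M"
    if c: "cond_iii n \<uu> M" and ck: "cokahler_structure br J \<xi> \<alpha> ip" for J \<xi> \<alpha> ip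
  proof -
    obtain m b1 where m: "m \<noteq> 0" and b1: "b1 \<in> \<uu>" "b1 \<noteq> 0" "M b1 = m *\<^sub>R b1"
      using c diag_block_cokahler(4)[OF ctx] unfolding cond_iii_def by blast
    have "br \<xi> b1 = (a \<xi> * m) *\<^sub>R b1"
      using br_ideal[OF b1(1), of \<xi>] unfolding ideal(3)[OF b1(1), symmetric] b1(3) by simp
    \<comment> \<open>A skew operator has no nonzero real eigenvalue, so the eigenvalue
      \<open>a \<xi> * m\<close> at \<open>b1\<close> must vanish.\<close>
    moreover have "ip (br \<xi> b1) b1 = 0"
      using cokahler_ad_skew[OF ck lie, of b1 b1] cokahler_ip(3)[OF ck, of b1 "br \<xi> b1"] by linarith
    ultimately have "a \<xi> * m * ip b1 b1 = 0" using cokahler_ip(2)[OF ck] by metis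
    then have a\<xi>: "a \<xi> = 0" using m b1(2) cokahler_ip(8)[OF ck] by auto
    have "ip e0 (br \<xi> y) = 0" if "y \<in> \<uu>" for y
      using br_ideal[OF that, of \<xi>] a\<xi> cokahler_ip(7)[OF ck] by simp
    then have "br e0 \<xi> = 0" using cokahler_br_e0_zero[OF ctx ck] by blast
    then show ?thesis using a\<xi> ker_on_ideal[OF ctx] by blast
  qed
  show ?thesis
  proof (intro conjI impI allI)
    show "\<exists>J \<alpha> ip. cokahler_structure br J (t *\<^sub>R e0 + w) \<alpha> ip"
      if "cond_i n \<uu> M" "t \<noteq> 0 \<and> w \<in> \<uu>" for t w
      by (rule cokahler_structure_off_ideal[OF ctx i_un]) (use that in auto)
    show "\<exists>t w. t \<noteq> 0 \<and> w \<in> \<uu> \<and> \<xi> = t *\<^sub>R e0 + w"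
      if "cond_i n \<uu> M" "cokahler_structure br J \<xi> \<alpha> ip" for J \<xi> \<alpha> ip
      using that by (rule part1)
    show "\<exists>J \<alpha> ip. cokahler_structure br J (\<delta>1 *\<^sub>R e0 + \<delta>2 *\<^sub>R u0) \<alpha> ip"
      if "cond_ii n \<uu> M" "u0 \<in> ker_on \<uu> M \<and> \<delta>1 *\<^sub>R e0 + \<delta>2 *\<^sub>R u0 \<noteq> 0" for \<delta>1 \<delta>2 u0
      using that by (intro part2a) auto
    show "\<exists>\<delta>1 \<delta>2 u0. u0 \<in> ker_on \<uu> M \<and> \<xi> = \<delta>1 *\<^sub>R e0 + \<delta>2 *\<^sub>R u0 \<and> \<xi> \<noteq> 0"
      if "cokahler_structure br J \<xi> \<alpha> ip \<and> ip e0 e0 = 1 \<and> (\<forall>x\<in>\<uu>. ip e0 x = 0)" for J \<xi> \<alpha> ip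
      by (rule part2b[of J \<xi> \<alpha> ip]) (use that in blast)+
    show "\<exists>J \<alpha> ip. cokahler_structure br J \<xi> \<alpha> ip \<and> ip \<xi> \<xi> = 1"
      if c: "cond_iii n \<uu> M" and \<xi>: "\<xi> \<in> ker_on \<uu> M \<and> \<xi> \<noteq> 0" for \<xi>
    proof -
      obtain J \<alpha> ip where "cokahler_structure br J \<xi> \<alpha> ip" using kernel c \<xi> by blast
      then show ?thesis using cokahler_unit by blast
    qed
    show "\<xi> \<in> ker_on \<uu> M" "ip \<xi> \<xi> = 1"
      if "cond_iii n \<uu> M" "cokahler_structure br J \<xi> \<alpha> ip" for J \<xi> \<alpha> ip
      by (rule part3[OF that]) (rule cokahler_unit[OF that(2)])
  qed (use part0 in blast)
qed

end
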